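(* Let $n\ge1$, $s\in\{0,1,\ldots,n-1\}$, and $f\in C^2(\mathbb{R}^n,\mathbb{R})$. Assume that the restriction $f_{|\mathbb{R}^{n,s}}$ is proper (i.e. $f^{-1}(K)\cap\mathbb{R}^{n,s}$ is compact for any compact set $K\subset\mathbb{R}$) and lower bounded, and that all M-stationary points of SCNO are nondegenerate. Additionally, assume that there exists a connected lower level set $M^d=\{x\in\mathbb{R}^{n,s}: f(x)\le d\}$, $d\in\mathbb{R}$, which contains all M-stationary points. Then $$r_I+(n-s)\,r_{II}\ \ge\ r-1,$$ where $r$ is the number of local minimizers of SCNO, and $r_I$ and $r_{II}$ are the numbers of M-stationary points with M-index equal to one of type (I) and of type (II), respectively.
   Context: For $x\in\mathbb{R}^n$, $\|x\|_0$ is the number of non-zero entries of $x$, and $\mathbb{R}^{n,s}=\{x\in\mathbb{R}^n : \|x\|_0\le s\}$. SCNO is the problem $\min f(x)$ s.t. $x\in\mathbb{R}^{n,s}$. For $x\in\mathbb{R}^{n,s}$ put $I_0(x)=\{i: x_i=0\}$ and $I_1(x)=\{i: x_i\neq 0\}$. A point $\bar x\in\mathbb{R}^{n,s}$ is M-stationary if $\frac{\partial f}{\partial x_i}(\bar x)=0$ for all $i\in I_1(\bar x)$. An M-stationary point $\bar x$ with $\|\bar x\|_0=k$ is nondegenerate if: (ND1) if $k<s$ then $\frac{\partial f}{\partial x_i}(\bar x)\ne0$ for all $i\in I_0(\bar x)$; and (ND2) the matrix $\left(\frac{\partial^2 f}{\partial x_i\partial x_j}(\bar x)\right)_{i,j\in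 I_1(\bar x)}$ is nonsingular. The quadratic index $QI$ of a nondegenerate M-stationary point is the number of negative eigenvalues of the matrix in ND2, and its M-index is $s-k+QI$. A nondegenerate M-stationary point with M-index equal to one, i.e. $s-k+QI=1$, is of type (I) if $k=s$ and $QI=1$, and of type (II) if $k=s-1$ and $QI=0$. *)

theory Defs
  imports "Jordan_Normal_Form.Char_Poly" "HOL-Analysis.Analysis"
begin

(* Jordan_Normal_Form and HOL-Analysis both use the infix $; here it is the component of a
   vector in real ^ 'n. *)
no_notation Matrix.vec_index (infixl \<open>$\<close> 100)

definition partial_deriv :: "'n::finite \<Rightarrow> (real ^ 'n \<Rightarrow> real) \<Rightarrow> real ^ 'n \<Rightarrow> real" where
  "partial_deriv i f x = deriv (\<lambda>t. f (x + t *\<^sub>R axis i 1)) 0"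

primrec C_k :: "nat \<Rightarrow> (real ^ 'n::finite \<Rightarrow> real) \<Rightarrow> bool" where
  "C_k 0 f \<longleftrightarrow> continuous_on UNIV f"
| "C_k (Suc k) f \<longleftrightarrow> f differentiable_on UNIV \<and> (\<forall>i. C_k k (partial_deriv i f))"

definition I0 :: "real ^ 'n::finite \<Rightarrow> 'n set" where
  "I0 x = {i. x $ i = 0}"

definition I1 :: "real ^ 'n::finite \<Rightarrow> 'n set" where
  "I1 x = {i. x $ i \<noteq> 0}"

definition l0_norm :: "real ^ 'n::finite \<Rightarrow> nat" where
  "l0_norm x = card (I1 x)"

definition sparse_vecs :: "nat \<Rightarrow> (real ^ 'n::finite) set" where
  "sparse_vecs s = {x. l0_norm x \<le> s}"

definition local_minimizer :: "(real ^ 'n::finite \<Rightarrow> real) \<Rightarrow> nat \<Rightarrow> real ^ 'n \<Rightarrow> bool" where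
  "local_minimizer f s x \<longleftrightarrow>
     x \<in> sparse_vecs s \<and> (\<exists>e>0. \<forall>y \<in> sparse_vecs s \<inter> ball x e. f x \<le> f y)"

definition lower_level_set :: "(real ^ 'n::finite \<Rightarrow> real) \<Rightarrow> nat \<Rightarrow> real \<Rightarrow> (real ^ 'n) set" where
  "lower_level_set f s d = {x \<in> sparse_vecs s. f x \<le> d}"

definition M_stationary :: "(real ^ 'n::finite \<Rightarrow> real) \<Rightarrow> nat \<Rightarrow> real ^ 'n \<Rightarrow> bool" where
  "M_stationary f s x \<longleftrightarrow> x \<in> sparse_vecs s \<and> (\<forall>i \<in> I1 x. partial_deriv i f x = 0)"

(* The second partial derivatives with both indices in I1 x, arranged in a square matrix of size
   card (I1 x) along the library's enumeration of the finite set I1 x. A different enumeration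
   conjugates the matrix by a permutation, which changes neither its invertibility nor its
   eigenvalues. *)
definition restricted_hessian :: "(real ^ 'n::finite \<Rightarrow> real) \<Rightarrow> real ^ 'n \<Rightarrow> real Matrix.mat" where
  "restricted_hessian f x =
     (let e = from_nat_into (I1 x); k = card (I1 x)
      in Matrix.mat k k (\<lambda>(a, b). partial_deriv (e a) (partial_deriv (e b) f) x))"

(* Eigenvalues are counted with multiplicity. *)
definition num_neg_eigenvalues :: "real Matrix.mat \<Rightarrow> nat" where
  "num_neg_eigenvalues A = size (filter_mset (\<lambda>c. c < 0) (proots (char_poly A)))"

definition quadratic_index :: "(real ^ 'n::finite \<Rightarrow> real) \<Rightarrow> real ^ 'n \<Rightarrow> nat" where
  "quadratic_index f x = num_neg_eigenvalues (restricted_hessian f x)"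

definition nondegenerate :: "(real ^ 'n::finite \<Rightarrow> real) \<Rightarrow> nat \<Rightarrow> real ^ 'n \<Rightarrow> bool" where
  "nondegenerate f s x \<longleftrightarrow>
     (l0_norm x < s \<longrightarrow> (\<forall>i \<in> I0 x. partial_deriv i f x \<noteq> 0)) \<and>
     invertible_mat (restricted_hessian f x)"

definition M_index :: "(real ^ 'n::finite \<Rightarrow> real) \<Rightarrow> nat \<Rightarrow> real ^ 'n \<Rightarrow> nat" where
  "M_index f s x = s - l0_norm x + quadratic_index f x"

definition type_I :: "(real ^ 'n::finite \<Rightarrow> real) \<Rightarrow> nat \<Rightarrow> real ^ 'n \<Rightarrow> bool" where
  "type_I f s x \<longleftrightarrow>
     M_stationary f s x \<and> nondegenerate f s x \<and> M_index f s x = 1 \<and>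
     l0_norm x = s \<and> quadratic_index f x = 1"

(* k = s - 1 is written k + 1 = s because subtraction on nat truncates at s = 0. *)
definition type_II :: "(real ^ 'n::finite \<Rightarrow> real) \<Rightarrow> nat \<Rightarrow> real ^ 'n \<Rightarrow> bool" where
  "type_II f s x \<longleftrightarrow>
     M_stationary f s x \<and> nondegenerate f s x \<and> M_index f s x = 1 \<and>
     l0_norm x + 1 = s \<and> quadratic_index f x = 0"

end

theory Submission
  imports Defs
begin

text \<open>
  The merging of components of sublevel sets is studied directly, without a gradient flow. At each
  feasible point \<open>x\<close> the components of the strict sublevel set \<open>{f < f x}\<close> having \<open>x\<close> in their closure are
  at most \<open>2\<close> for type (I), at most \<open>n - s + 1\<close> for type (II), and at most \<open>1\<close> otherwise. Choose a minimizer
  in each of these components and join them by a star of at most \<open>1\<close>, \<open>n - s\<close> or \<open>0\<close> edges. By the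
  mountain pass principle two minimizers in one connected level set are linked by such edges, so the edges
  form a connected graph on the \<open>r\<close> minimizers and there are at least \<open>r - 1\<close> of them.
\<close>

section \<open>Symmetry of second partial derivatives\<close>

no_notation Matrix.scalar_prod (infix \<open>\<bullet>\<close> 70)

text \<open>The obstacle is that \<open>sparse_vecs s\<close> is a union of coordinate subspaces and
  not a manifold, so every path is built from explicit segments whose supports must be checked. The
  local bounds come from the room that the support leaves, with k the number of nonzero entries of
  x. If k = s, all feasible points near x have the support of x; the problem is smooth there, and
  the strict sublevel set looks like the unit sphere of the negative eigenspace: empty, two points,
  or connected. If k < s, ND1 gives descent, for one choice of sign, along every zero coordinate,
  hence n - k targets, one for each coordinate switched on; for k = s - 1 these are n - s + 1. The
  targets are joined to each other when two coordinates may be switched on together (k at most s -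
  2), or when a negative direction on the support allows a passage below x (QI positive). So more
  than one component needs M-index one. Since \<open>quadratic_index\<close> counts roots of a
  characteristic polynomial, an orthonormal eigenbasis is built to read it as the dimension of the
  negative eigenspace.\<close>

lemma has_derivative_partial_deriv:
  fixes f :: "real ^ 'n::finite \<Rightarrow> real"
  assumes "f differentiable_on UNIV"
  shows "(f has_derivative (\<lambda>h. \<Sum>i\<in>UNIV. partial_deriv i f x * h $ i)) (at x)"
proof -
  obtain D where D: "(f has_derivative D) (at x)"
    using assms by (auto simp: differentiable_on_def differentiable_def)
  interpret D: bounded_linear D using D by (rule has_derivative_bounded_linear)
  have pd: "partial_deriv i f x = D (axis i 1)" for i
  proof -
    have "((\<lambda>t::real. f (x + t *\<^sub>R axis i 1)) has_derivative (\<lambda>t. D (t *\<^sub>R axis i 1))) (at 0)"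
    proof (rule has_derivative_compose[where g = f and f = "\<lambda>t. x + t *\<^sub>R axis i 1"])
      show "((\<lambda>t::real. x + t *\<^sub>R axis i 1) has_derivative (\<lambda>t. t *\<^sub>R axis i 1)) (at 0)"
        by (auto intro!: derivative_eq_intros)
      show "(f has_derivative D) (at (x + (0::real) *\<^sub>R axis i 1))" using D by simp
    qed
    moreover have "(\<lambda>t. D (t *\<^sub>R axis i 1)) = (*) (D (axis i 1))"
      by (simp add: fun_eq_iff D.scaleR)
    ultimately have "((\<lambda>t::real. f (x + t *\<^sub>R axis i 1)) has_real_derivative D (axis i 1)) (at 0)"
      by (simp add: has_field_derivative_def)
    then show ?thesis unfolding partial_deriv_def by (rule DERIV_imp_deriv)
  qed
  have "D h = (\<Sum>i\<in>UNIV. D (axis i 1) * h $ i)" for h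
  proof -
    have "D h = D (\<Sum>i\<in>UNIV. (h $ i) *\<^sub>R axis i 1)" using basis_expansion[of h]
      by (simp add: scalar_mult_eq_scaleR)
    also have "\<dots> = (\<Sum>i\<in>UNIV. D (axis i 1) * h $ i)" by (simp add: D.sum D.scaleR mult.commute)
    finally show ?thesis .
  qed
  then have "D = (\<lambda>h. \<Sum>i\<in>UNIV. partial_deriv i f x * h $ i)" unfolding pd by (rule ext)
  from D[unfolded this] show ?thesis .
qed

lemma has_real_derivative_along_line:
  fixes f :: "real ^ 'n::finite \<Rightarrow> real"
  assumes "f differentiable_on UNIV"
  shows "((\<lambda>t. f (x + t *\<^sub>R v)) has_real_derivative
    (\<Sum>i\<in>UNIV. partial_deriv i f (x + t *\<^sub>R v) * v $ i)) (at t)"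
proof -
  have "((\<lambda>t. f (x + t *\<^sub>R v)) has_derivative
     (\<lambda>h. \<Sum>i\<in>UNIV. partial_deriv i f (x + t *\<^sub>R v) * (h *\<^sub>R v) $ i)) (at t)"
  proof (rule has_derivative_compose[where g = f and f = "\<lambda>t. x + t *\<^sub>R v"])
    show "((\<lambda>t::real. x + t *\<^sub>R v) has_derivative (\<lambda>t. t *\<^sub>R v)) (at t)"
      by (auto intro!: derivative_eq_intros)
  qed (rule has_derivative_partial_deriv[OF assms])
  moreover have "(\<lambda>h. \<Sum>i\<in>UNIV. partial_deriv i f (x + t *\<^sub>R v) * (h *\<^sub>R v) $ i)
     = (*) (\<Sum>i\<in>UNIV. partial_deriv i f (x + t *\<^sub>R v) * v $ i)"
    by (simp add: fun_eq_iff sum_distrib_left mult_ac)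
  ultimately show ?thesis by (simp add: has_field_derivative_def)
qed

lemma has_real_derivative_along_axis:
  fixes f :: "real ^ 'n::finite \<Rightarrow> real"
  assumes "f differentiable_on UNIV"
  shows "((\<lambda>t. f (x + t *\<^sub>R axis i 1)) has_real_derivative
    partial_deriv i f (x + t *\<^sub>R axis i 1)) (at t)"
proof -
  have *: "(\<Sum>j\<in>UNIV. g j * axis i 1 $ j) = g i" for g :: "'n \<Rightarrow> real"
    by (simp add: axis_def if_distrib cong: if_cong)
  show ?thesis using has_real_derivative_along_line[OF assms, of x "axis i 1" t] unfolding * .
qed

text \<open>Two mean value steps: in direction i for the difference of f between two parallel lines,
  then in direction j for \<open>partial_deriv i f\<close>. The left side is symmetric in i and j
  while the right side is not, which is what the symmetry proof exploits.\<close>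

lemma second_difference_mean_value:
  fixes f :: "real ^ 'n::finite \<Rightarrow> real"
  assumes f: "f differentiable_on UNIV" and g: "partial_deriv i f differentiable_on UNIV"
    and h: "0 < h"
  obtains p where "norm (p - x) \<le> 2 * h"
    "f (x + h *\<^sub>R axis i 1 + h *\<^sub>R axis j 1) - f (x + h *\<^sub>R axis i 1) - f (x + h *\<^sub>R axis j 1) + f x
      = h\<^sup>2 * partial_deriv j (partial_deriv i f) p"
proof -
  define \<phi> where "\<phi> s = f (x + h *\<^sub>R axis j 1 + s *\<^sub>R axis i 1) - f (x + s *\<^sub>R axis i 1)" for s
  have "(\<phi> has_real_derivative partial_deriv i f (x + h *\<^sub>R axis j 1 + s *\<^sub>R axis i 1)
       - partial_deriv i f (x + s *\<^sub>R axis i 1)) (at s)" for s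
    unfolding \<phi>_def by (intro DERIV_diff has_real_derivative_along_axis f)
  then obtain s where s: "0 < s" "s < h" and \<phi>: "\<phi> h - \<phi> 0 =
      (h - 0) * (partial_deriv i f (x + h *\<^sub>R axis j 1 + s *\<^sub>R axis i 1)
       - partial_deriv i f (x + s *\<^sub>R axis i 1))"
    using MVT2[OF h, of \<phi> "\<lambda>s. partial_deriv i f (x + h *\<^sub>R axis j 1 + s *\<^sub>R axis i 1)
       - partial_deriv i f (x + s *\<^sub>R axis i 1)"] by blast
  obtain t where t: "0 < t" "t < h" and \<psi>: "partial_deriv i f (x + s *\<^sub>R axis i 1 + h *\<^sub>R axis j 1)
       - partial_deriv i f (x + s *\<^sub>R axis i 1 + 0 *\<^sub>R axis j 1) =
      (h - 0) * partial_deriv j (partial_deriv i f) (x + s *\<^sub>R axis i 1 + t *\<^sub>R axis j 1)"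
    using MVT2[OF h has_real_derivative_along_axis[OF g, of "x + s *\<^sub>R axis i 1" j]] by blast
  let ?p = "x + s *\<^sub>R axis i 1 + t *\<^sub>R axis j 1"
  have "norm (?p - x) \<le> norm (s *\<^sub>R axis i (1::real) :: real ^ 'n) + norm (t *\<^sub>R axis j (1::real) :: real ^ 'n)"
    by (metis add.assoc add_diff_cancel_left' norm_triangle_ineq)
  also have "\<dots> \<le> 2 * h" using s t by (simp add: norm_axis_1)
  finally have "norm (?p - x) \<le> 2 * h" .
  moreover have "f (x + h *\<^sub>R axis i 1 + h *\<^sub>R axis j 1) - f (x + h *\<^sub>R axis i 1) - f (x + h *\<^sub>R axis j 1) + f x
      = h\<^sup>2 * partial_deriv j (partial_deriv i f) ?p"
  proof -
    have "f (x + h *\<^sub>R axis i 1 + h *\<^sub>R axis j 1) - f (x + h *\<^sub>R axis i 1) - f (x + h *\<^sub>R axis j 1) + f x = \<phi> h - \<phi> 0"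
      by (simp add: \<phi>_def add_ac)
    also have "\<dots> = h * (partial_deriv i f (x + s *\<^sub>R axis i 1 + h *\<^sub>R axis j 1)
       - partial_deriv i f (x + s *\<^sub>R axis i 1 + 0 *\<^sub>R axis j 1))"
      unfolding \<phi> by (simp add: add_ac)
    also have "\<dots> = h\<^sup>2 * partial_deriv j (partial_deriv i f) ?p"
      unfolding \<psi> by (simp add: power2_eq_square)
    finally show ?thesis .
  qed
  ultimately show ?thesis by (rule that)
qed

text \<open>One and the same second difference equals \<open>h\<^sup>2\<close> times either mixed
  derivative at points within 2 * h of x; continuity then leaves no gap between them. The result is
  needed to make \<open>hess\<close> self-adjoint.\<close>

lemma partial_deriv_commute:
  fixes f :: "real ^ 'n::finite \<Rightarrow> real"
  assumes "C_k 2 f"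
  shows "partial_deriv i (partial_deriv j f) x = partial_deriv j (partial_deriv i f) x"
proof (rule ccontr)
  let ?A = "partial_deriv i (partial_deriv j f)" and ?B = "partial_deriv j (partial_deriv i f)"
  assume ne: "?A x \<noteq> ?B x"
  have f: "f differentiable_on UNIV" and df: "\<And>i. partial_deriv i f differentiable_on UNIV"
    and cont: "\<And>i j. continuous_on UNIV (partial_deriv i (partial_deriv j f))"
    using assms by (auto simp: numeral_2_eq_2)
  define e where "e = \<bar>?A x - ?B x\<bar> / 2"
  have e: "e > 0" using ne by (simp add: e_def)
  obtain d1 where d1: "d1 > 0" "\<And>y. dist y x < d1 \<Longrightarrow> dist (?A y) (?A x) < e"
    using cont[of i j] e unfolding continuous_on_iff by blast
  obtain d2 where d2: "d2 > 0" "\<And>y. dist y x < d2 \<Longrightarrow> dist (?B y) (?B x) < e"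
    using cont[of j i] e unfolding continuous_on_iff by blast
  define h where "h = min d1 d2 / 3"
  have h: "h > 0" "2 * h < d1" "2 * h < d2" using d1 d2 by (auto simp: h_def)
  obtain p where p: "norm (p - x) \<le> 2 * h" and pe:
    "f (x + h *\<^sub>R axis j 1 + h *\<^sub>R axis i 1) - f (x + h *\<^sub>R axis j 1) - f (x + h *\<^sub>R axis i 1) + f x = h\<^sup>2 * ?A p"
    using second_difference_mean_value[OF f df h(1)] by blast
  obtain q where q: "norm (q - x) \<le> 2 * h" and qe:
    "f (x + h *\<^sub>R axis i 1 + h *\<^sub>R axis j 1) - f (x + h *\<^sub>R axis i 1) - f (x + h *\<^sub>R axis j 1) + f x = h\<^sup>2 * ?B q"
    using second_difference_mean_value[OF f df h(1)] by blast
  have "x + h *\<^sub>R axis j 1 + h *\<^sub>R axis i 1 = x + h *\<^sub>R axis i 1 + h *\<^sub>R axis j 1"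
    by (simp add: add_ac)
  from arg_cong[OF this, of f] pe qe have "h\<^sup>2 * ?A p = h\<^sup>2 * ?B q" by linarith
  then have "?A p = ?B q" using h by simp
  moreover have "\<bar>?A p - ?A x\<bar> < e" "\<bar>?B q - ?B x\<bar> < e"
    using d1(2)[of p] d2(2)[of q] p q h by (auto simp: dist_norm)
  ultimately have "\<bar>?A x - ?B x\<bar> < 2 * e" by linarith
  then show False by (simp add: e_def)
qed

section \<open>Eigenvalues of the restricted Hessian\<close>

text \<open>A maximizer v of the Rayleigh quotient on the unit sphere of V is an eigenvector: the
  form \<open>g\<close> is nonnegative on V and vanishes at v, so its first variation in the
  direction of the residual \<open>c *\<^sub>R v - L v\<close> must vanish, and that variation is
  twice the squared norm of the residual.\<close>

lemma selfadjoint_eigenvector: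
  fixes L :: "'a::euclidean_space \<Rightarrow> 'a"
  assumes L: "linear L" and V: "subspace V" and LV: "\<And>x. x \<in> V \<Longrightarrow> L x \<in> V"
    and sym: "\<And>x y. x \<in> V \<Longrightarrow> y \<in> V \<Longrightarrow> L x \<bullet> y = x \<bullet> L y" and ne: "V \<noteq> {0}"
  obtains v c where "v \<in> V" "norm v = 1" "L v = c *\<^sub>R v"
proof -
  interpret L: linear L by fact
  let ?S = "V \<inter> sphere 0 1"
  have "compact ?S" by (simp add: V closed_subspace closed_Int_compact)
  moreover obtain x where "x \<in> V" "x \<noteq> 0" using ne subspace_0[OF V] by auto
  then have "x /\<^sub>R norm x \<in> ?S" by (simp add: V subspace_scale)
  then have "?S \<noteq> {}" by blast
  moreover have "continuous_on ?S (\<lambda>x. L x \<bullet> x)"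
    by (intro continuous_intros linear_continuous_on linear_conv_bounded_linear[THEN iffD1] L)
  ultimately obtain v where "v \<in> ?S" and max: "\<And>y. y \<in> ?S \<Longrightarrow> L y \<bullet> y \<le> L v \<bullet> v"
    using continuous_attains_sup[of ?S "\<lambda>x. L x \<bullet> x"] by blast
  then have v: "v \<in> V" "norm v = 1" by auto
  define c where "c = L v \<bullet> v"
  have vv: "v \<bullet> v = 1" using v by (simp add: norm_eq_1)
  define g where "g x = c * (x \<bullet> x) - L x \<bullet> x" for x
  have g: "g x \<ge> 0" if "x \<in> V" for x
  proof (cases "x = 0")
    case False
    have "L (x /\<^sub>R norm x) \<bullet> (x /\<^sub>R norm x) \<le> c"
      unfolding c_def using False that by (intro max) (simp add: V subspace_scale)
    then have "L x \<bullet> x \<le> c * (norm x)\<^sup>2" using False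
      by (simp add: L.scaleR field_simps power2_eq_square)
    then show ?thesis by (simp add: g_def dot_square_norm)
  qed (simp add: g_def)
  define w where "w = c *\<^sub>R v - L v"
  have w: "w \<in> V" by (simp add: w_def V LV v subspace_diff subspace_scale)
  have exp: "g (v + t *\<^sub>R w) = 2 * t * (w \<bullet> w) + t\<^sup>2 * g w" for t
  proof -
    have "L w \<bullet> v = w \<bullet> L v" using sym[OF w v(1)] .
    then have "g (v + t *\<^sub>R w) = g v + 2 * t * ((c *\<^sub>R v - L v) \<bullet> w) + t\<^sup>2 * g w"
      by (simp add: g_def L.add L.scaleR inner_simps inner_commute algebra_simps power2_eq_square)
    moreover have "g v = 0" by (simp add: g_def c_def vv)
    ultimately show ?thesis by (simp add: w_def)
  qed
  have nn: "2 * t * (w \<bullet> w) + t\<^sup>2 * g w \<ge> 0" for t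
    using g[of "v + t *\<^sub>R w"] exp[of t] V v w by (simp add: subspace_add subspace_scale)
  have "w \<bullet> w \<le> 0"
  proof (cases "g w = 0")
    case True
    then show ?thesis using nn[of "-1"] by simp
  next
    case False
    then have gw: "g w > 0" using g[OF w] by simp
    \<comment> \<open>The chosen t minimizes the quadratic 2 t (w \<bullet> w) + t^2 g w.\<close>
    have "2 * (- (w \<bullet> w) / g w) * (w \<bullet> w) + (- (w \<bullet> w) / g w)\<^sup>2 * g w = - ((w \<bullet> w)\<^sup>2 / g w)"
      using gw by (simp add: field_simps power2_eq_square)
    with nn[of "- (w \<bullet> w) / g w"] have "(w \<bullet> w)\<^sup>2 / g w \<le> 0" by linarith
    then show ?thesis using gw by (simp add: divide_le_0_iff)
  qed
  then have "w = 0" by (meson inner_gt_zero_iff not_le)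
  then have "L v = c *\<^sub>R v" by (simp add: w_def)
  then show thesis using that v by blast
qed

text \<open>Induction on the dimension: symmetry keeps the orthogonal complement of an eigenvector
  inside V invariant under L. Working with subspaces V instead of the whole space is what lets the
  induction, and later \<open>coord_space\<close>, fit the statement.\<close>

lemma selfadjoint_eigenbasis:
  fixes L :: "'a::euclidean_space \<Rightarrow> 'a"
  assumes L: "linear L" and V: "subspace V" and LV: "\<And>x. x \<in> V \<Longrightarrow> L x \<in> V"
    and sym: "\<And>x y. x \<in> V \<Longrightarrow> y \<in> V \<Longrightarrow> L x \<bullet> y = x \<bullet> L y"
  shows "\<exists>B \<mu>. finite B \<and> pairwise orthogonal B \<and> (\<forall>b\<in>B. norm b = 1 \<and> L b = \<mu> b *\<^sub>R b) \<and> span B = V"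
  using V LV sym
proof (induction "dim V" arbitrary: V rule: less_induct)
  case less
  show ?case
  proof (cases "V = {0}")
    case True
    then show ?thesis by (intro exI[of _ "{}"]) auto
  next
    case False
    obtain v c where v: "v \<in> V" "norm v = 1" "L v = c *\<^sub>R v"
      using selfadjoint_eigenvector[OF L less.prems False] by blast
    let ?W = "V \<inter> {x. v \<bullet> x = 0}"
    have W: "subspace ?W" using less.prems(1) subspace_hyperplane by (rule subspace_inter)
    have "v \<notin> ?W" using v by auto
    then have "?W \<subset> V" using v(1) by blast
    moreover have "span ?W = ?W" "span V = V" using W less.prems(1) by (simp_all only: span_eq_iff)
    ultimately have "dim ?W < dim V" by (metis dim_psubset)
    moreover have "L x \<in> ?W" if "x \<in> ?W" for x
      using that less.prems(2,3) v less.prems(3)[of v x] by auto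
    ultimately obtain B \<mu> where B: "finite B" "pairwise orthogonal B"
      "\<And>b. b \<in> B \<Longrightarrow> norm b = 1 \<and> L b = \<mu> b *\<^sub>R b" "span B = ?W"
      using less.hyps[OF _ W] less.prems(3) by (metis (no_types, lifting) IntE)
    have BW: "b \<in> V \<and> v \<bullet> b = 0" if "b \<in> B" for b using span_base[OF that] B(4) by auto
    have "v \<notin> B" using BW[of v] v by auto
    show ?thesis
    proof (intro exI conjI)
      show "finite (insert v B)" using B by simp
      show "pairwise orthogonal (insert v B)"
        using B(2) BW by (auto simp: pairwise_insert orthogonal_def inner_commute)
      show "\<forall>b\<in>insert v B. norm b = 1 \<and> L b = (\<mu>(v := c)) b *\<^sub>R b"
        using B(3) v \<open>v \<notin> B\<close> by auto
      show "span (insert v B) = V"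
      proof
        show "span (insert v B) \<subseteq> V" using v BW less.prems(1) by (intro span_minimal) auto
        show "V \<subseteq> span (insert v B)"
        proof
          fix x assume x: "x \<in> V"
          have "x - (v \<bullet> x) *\<^sub>R v \<in> span B" unfolding B(4)
            using x v less.prems(1) by (auto simp: subspace_diff subspace_scale inner_diff_right norm_eq_1)
          then show "x \<in> span (insert v B)" by (auto simp: span_insert)
        qed
      qed
    qed
  qed
qed

lemma orthonormal_inner:
  assumes "pairwise orthogonal B" "\<And>b. b \<in> B \<Longrightarrow> norm b = 1" "b \<in> B" "b' \<in> B"
  shows "b \<bullet> b' = (if b = b' then 1 else 0)"
  using assms by (auto simp: pairwise_def orthogonal_def norm_eq_1)

text \<open>For \<open>I = I1 x\<close> this is the tangent space at x of the set of points with the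
  support of x.\<close>

definition coord_space :: "'n set \<Rightarrow> (real ^ 'n::finite) set" where
  "coord_space I = {h. \<forall>i. i \<notin> I \<longrightarrow> h $ i = 0}"

lemma subspace_coord_space: "subspace (coord_space I)"
  by (simp add: coord_space_def subspace_def)

lemma dim_coord_space: "dim (coord_space (I :: 'n::finite set)) = card I"
proof -
  let ?B = "(\<lambda>i. axis i (1::real)) ` I"
  have "coord_space I \<subseteq> span ?B"
  proof
    fix h :: "real ^ 'n" assume "h \<in> coord_space I"
    then have "(\<Sum>i\<in>UNIV. (h $ i) *\<^sub>R axis i (1::real)) = (\<Sum>i\<in>I. (h $ i) *\<^sub>R axis i (1::real))"
      by (intro sum.mono_neutral_right) (auto simp: coord_space_def)
    then have "h = (\<Sum>i\<in>I. (h $ i) *\<^sub>R axis i (1::real))"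
      using basis_expansion[of h] by (simp add: scalar_mult_eq_scaleR)
    then show "h \<in> span ?B" by (metis (no_types, lifting) imageI span_base span_scale span_sum)
  qed
  moreover have "span ?B \<subseteq> coord_space I"
    by (intro span_minimal subspace_coord_space) (auto simp: coord_space_def axis_def)
  moreover have "pairwise orthogonal ?B" "0 \<notin> ?B"
    by (auto simp: pairwise_def orthogonal_def inner_axis_axis axis_eq_0_iff)
  then have "independent ?B" by (rule pairwise_orthogonal_independent)
  moreover have "card ?B = card I" by (intro card_image) (auto simp: inj_on_def axis_eq_axis)
  ultimately show ?thesis by (metis dim_eq_card_independent dim_span subset_antisym)
qed

lemma inner_coord_space:
  fixes x y :: "real ^ 'n::finite"
  assumes "x \<in> coord_space I"
  shows "x \<bullet> y = (\<Sum>i\<in>I. x $ i * y $ i)"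
proof -
  have "(\<Sum>i\<in>UNIV. x $ i * y $ i) = (\<Sum>i\<in>I. x $ i * y $ i)"
    using assms by (intro sum.mono_neutral_right) (auto simp: coord_space_def)
  then show ?thesis by (simp add: inner_vec_def)
qed

text \<open>The bridge from eigenvectors in \<open>real ^ 'n\<close> to matrices indexed by numbers:
  \<open>e\<close> enumerates the support, \<open>g\<close> the eigenvectors, and the conjugating
  matrix P has the eigenvectors as columns. Orthonormality makes its transpose Q a left inverse,
  hence an inverse because both are square.\<close>

lemma similar_mat_diag_of_eigenbasis:
  fixes M :: "'n::finite \<Rightarrow> 'n \<Rightarrow> real" and I :: "'n set"
  defines "k \<equiv> card I"
  assumes e: "bij_betw e {..<k} I" and g: "bij_betw g {..<k} B"
    and B: "pairwise orthogonal B" "\<And>b. b \<in> B \<Longrightarrow> norm b = 1" "B \<subseteq> coord_space I"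
    and eig: "\<And>b i. b \<in> B \<Longrightarrow> i \<in> I \<Longrightarrow> (\<Sum>j\<in>I. M i j * b $ j) = \<mu> b * b $ i"
  shows "similar_mat (Matrix.mat k k (\<lambda>(a, b). M (e a) (e b))) (mat_diag k (\<lambda>c. \<mu> (g c)))"
proof -
  let ?A = "Matrix.mat k k (\<lambda>(a, b). M (e a) (e b))" and ?D = "mat_diag k (\<lambda>c. \<mu> (g c))"
  let ?P = "Matrix.mat k k (\<lambda>(a, c). g c $ e a)" and ?Q = "Matrix.mat k k (\<lambda>(c, a). g c $ e a)"
  have reindex: "(\<Sum>a = 0..<k. F (e a)) = (\<Sum>i\<in>I. F i)" for F :: "'n \<Rightarrow> real"
    using sum.reindex_bij_betw[OF e] by (simp add: atLeast0LessThan)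
  have gB: "g c \<in> B" if "c < k" for c using g that by (auto simp: bij_betw_def)
  have eI: "e a \<in> I" if "a < k" for a using e that by (auto simp: bij_betw_def)
  have QP: "?Q * ?P = 1\<^sub>m k"
  proof (rule eq_matI)
    fix c c' assume "c < dim_row (1\<^sub>m k :: real mat)" "c' < dim_col (1\<^sub>m k :: real mat)"
    then have c: "c < k" "c' < k" by auto
    then have "(?Q * ?P) $$ (c, c') = (\<Sum>a = 0..<k. g c $ e a * g c' $ e a)"
      by (simp add: scalar_prod_def)
    also have "\<dots> = g c \<bullet> g c'"
      using inner_coord_space[of "g c" I "g c'"] B(3) gB[OF c(1)] reindex[of "\<lambda>i. g c $ i * g c' $ i"] by auto
    also have "\<dots> = (if c = c' then 1 else 0)"
      using orthonormal_inner[OF B(1,2) gB[OF c(1)] gB[OF c(2)]] g c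
      by (auto simp: bij_betw_def inj_on_def)
    finally show "(?Q * ?P) $$ (c, c') = 1\<^sub>m k $$ (c, c')" using c by simp
  qed auto
  then have PQ: "?P * ?Q = 1\<^sub>m k" by (rule mat_mult_left_right_inverse[rotated 2]) auto
  have AP: "?A * ?P = ?P * ?D"
  proof (rule eq_matI)
    fix a c assume "a < dim_row (?P * ?D)" "c < dim_col (?P * ?D)"
    then have ac: "a < k" "c < k" by (auto simp: mat_diag_def)
    then have "(?A * ?P) $$ (a, c) = (\<Sum>b = 0..<k. M (e a) (e b) * g c $ e b)"
      by (simp add: scalar_prod_def)
    also have "\<dots> = \<mu> (g c) * g c $ e a"
      using reindex[of "\<lambda>j. M (e a) j * g c $ j"] eig[OF gB[OF ac(2)] eI[OF ac(1)]] by simp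
    also have "\<dots> = (?P * ?D) $$ (a, c)"
      using ac by (subst mat_diag_mult_right[of _ k]) auto
    finally show "(?A * ?P) $$ (a, c) = (?P * ?D) $$ (a, c)" .
  qed (auto simp: mat_diag_def)
  have "?A = ?A * (?P * ?Q)" by (simp add: PQ)
  also have "\<dots> = ?A * ?P * ?Q" by (rule assoc_mult_mat[symmetric]) auto
  also have "\<dots> = ?P * ?D * ?Q" by (simp only: AP)
  finally show ?thesis by (intro similar_matI[OF _ PQ QP]) auto
qed

lemma det_nonzero_if_invertible_mat:
  fixes A :: "'a::idom mat"
  assumes "invertible_mat A"
  shows "Determinant.det A \<noteq> 0"
proof -
  obtain B where A: "dim_row A = dim_col A" and AB: "A * B = 1\<^sub>m (dim_row A)" "B * A = 1\<^sub>m (dim_row B)"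
    using assms by (auto simp: invertible_mat_def inverts_mat_def)
  have "dim_row B = dim_col A" using AB(2) by (metis index_mult_mat(3) index_one_mat(3))
  moreover have "dim_col B = dim_row A" using AB(1) by (metis index_mult_mat(3) index_one_mat(3))
  ultimately have "Determinant.det (A * B) = Determinant.det A * Determinant.det B"
    using A by (intro det_mult[of _ "dim_row A"]) auto
  then show ?thesis using AB(1) by auto
qed

text \<open>Similarity preserves the characteristic polynomial and the determinant, and for a
  diagonal matrix both factor over the diagonal entries. So the roots with multiplicity are these
  entries, and none of them vanishes if the matrix is invertible.\<close>

lemma num_neg_eigenvalues_mat_diag:
  assumes "similar_mat A (mat_diag k l)"
  shows "num_neg_eigenvalues A = card {c. c < k \<and> l c < 0}"
    and "invertible_mat A \<Longrightarrow> c < k \<Longrightarrow> l c \<noteq> 0"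
proof -
  let ?D = "mat_diag k l"
  have ut: "upper_triangular ?D" by (auto simp: upper_triangular_def mat_diag_def)
  have diag: "diag_mat ?D = map l [0..<k]" by (simp add: diag_mat_def mat_diag_def)
  have "char_poly A = (\<Prod>a\<leftarrow>map l [0..<k]. [:- a, 1:])"
    using char_poly_upper_triangular[OF _ ut, of k] char_poly_similar[OF assms] diag by simp
  moreover have "proots (\<Prod>a\<leftarrow>xs. [:- a, 1:]) = mset xs" for xs :: "real list"
  proof (induction xs)
    case (Cons a xs)
    have "proots ([:- a, 1:] * (\<Prod>a\<leftarrow>xs. [:- a, 1:])) = add_mset a (mset xs)"
      using Cons by (subst proots_mult) (auto simp: prod_list_zero_iff)
    then show ?case by simp
  qed simp
  ultimately have pr: "proots (char_poly A) = mset (map l [0..<k])" by (simp only:)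
  have "num_neg_eigenvalues A = size (filter_mset (\<lambda>c. l c < 0) (mset_set {0..<k}))"
    unfolding num_neg_eigenvalues_def pr by (simp add: filter_mset_image_mset)
  also have "\<dots> = card {c. c < k \<and> l c < 0}"
    by (simp add: filter_mset_mset_set)
  finally show "num_neg_eigenvalues A = card {c. c < k \<and> l c < 0}" .
  have "Determinant.det A = (\<Prod>c\<leftarrow>[0..<k]. l c)"
    using det_upper_triangular[OF ut, of k] det_similar[OF assms] diag by simp
  then show "invertible_mat A \<Longrightarrow> c < k \<Longrightarrow> l c \<noteq> 0"
    using det_nonzero_if_invertible_mat[of A] by (auto simp: prod_list_zero_iff)
qed

section \<open>Sublevel sets near a nondegenerate critical point\<close>

text \<open>Stated for any orthonormal family of eigenvectors because it is applied to the negative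
  and to the positive eigenvectors separately.\<close>

lemma eigenbasis_span:
  fixes L :: "'a::euclidean_space \<Rightarrow> 'a"
  assumes L: "linear L" and S: "finite S" "pairwise orthogonal S"
    and eig: "\<And>b. b \<in> S \<Longrightarrow> norm b = 1 \<and> L b = \<mu> b *\<^sub>R b" and u: "u \<in> span S"
  shows "L u \<in> span S" "L u \<bullet> u = (\<Sum>b\<in>S. \<mu> b * (u \<bullet> b)\<^sup>2)" "u \<bullet> u = (\<Sum>b\<in>S. (u \<bullet> b)\<^sup>2)"
proof -
  interpret L: linear L by fact
  have exp: "u = (\<Sum>b\<in>S. (u \<bullet> b) *\<^sub>R b)"
    using orthonormal_basis_expand[OF S(2) _ u S(1)] eig by simp
  have "L u = L (\<Sum>b\<in>S. (u \<bullet> b) *\<^sub>R b)" using exp by simp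
  also have "\<dots> = (\<Sum>b\<in>S. (u \<bullet> b) *\<^sub>R (\<mu> b *\<^sub>R b))"
    by (simp add: L.sum L.scaleR eig)
  finally have Lu: "L u = (\<Sum>b\<in>S. (u \<bullet> b) *\<^sub>R (\<mu> b *\<^sub>R b))" .
  show "L u \<in> span S" unfolding Lu by (intro span_sum span_scale span_base)
  show "L u \<bullet> u = (\<Sum>b\<in>S. \<mu> b * (u \<bullet> b)\<^sup>2)"
    unfolding Lu inner_sum_left inner_scaleR_left
    by (intro sum.cong) (simp_all add: power2_eq_square inner_commute[of u])
  have "u \<bullet> u = (\<Sum>b\<in>S. (u \<bullet> b) *\<^sub>R b) \<bullet> u" using exp by simp
  then show "u \<bullet> u = (\<Sum>b\<in>S. (u \<bullet> b)\<^sup>2)"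
    unfolding inner_sum_left inner_scaleR_left by (simp add: inner_commute power2_eq_square)
qed

text \<open>The chord between two points of a sphere that are not antipodal misses the center: a
  zero would force equal weights 1/2 and then a = - b. It also stays in the ball, so a set
  containing the punctured ball of W contains it.\<close>

lemma path_component_sphere_segment:
  fixes a b :: "'a::real_normed_vector"
  assumes W: "subspace W" "a \<in> W" "b \<in> W" and n: "norm a = \<rho>" "norm b = \<rho>" "0 < \<rho>" "\<rho> < \<delta>"
    and ab: "a \<noteq> - b" and S: "\<And>u. u \<in> W \<Longrightarrow> u \<noteq> 0 \<Longrightarrow> norm u < \<delta> \<Longrightarrow> u \<in> S"
  shows "path_component S a b"
proof (rule path_component_linepath, rule subsetI)
  fix x assume "x \<in> closed_segment a b"
  then obtain t where t: "0 \<le> t" "t \<le> 1" and x: "x = (1 - t) *\<^sub>R a + t *\<^sub>R b"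
    by (auto simp: closed_segment_def)
  have "norm x \<le> (1 - t) * \<rho> + t * \<rho>"
    unfolding x using t n norm_triangle_ineq[of "(1 - t) *\<^sub>R a" "t *\<^sub>R b"] by simp
  then have "norm x < \<delta>" using n by (simp add: algebra_simps)
  moreover have "x \<noteq> 0"
  proof
    assume "x = 0"
    then have eq: "(1 - t) *\<^sub>R a = - (t *\<^sub>R b)" by (simp add: x eq_neg_iff_add_eq_0)
    then have "norm ((1 - t) *\<^sub>R a) = norm (t *\<^sub>R b)" by simp
    then have "t = 1/2" using t n by simp
    with eq have "(1/2) *\<^sub>R a = (1/2) *\<^sub>R (- b)" by (simp only:) simp
    then show False using ab by (simp only: scaleR_cancel_left) simp
  qed
  ultimately show "x \<in> S" using W by (intro S) (simp_all add: x subspace_add subspace_scale)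
qed

text \<open>A point of the negative set \<open>F < 0\<close> has a dominating negative component \<open>u\<close>; scaling \<open>u\<close> up keeps
  \<open>F\<close> decreasing until the positive component can be dropped, so the negative set near \<open>0\<close> retracts to
  a sphere in the negative eigenspace, which is empty, two points, or connected.\<close>

lemma negative_set_near_critical_point:
  fixes F :: "'a::euclidean_space \<Rightarrow> real" and G L :: "'a \<Rightarrow> 'a"
  assumes L: "linear L" and B: "finite B" "pairwise orthogonal B"
    and eig: "\<And>b. b \<in> B \<Longrightarrow> norm b = 1 \<and> L b = \<mu> b *\<^sub>R b" and \<mu>0: "\<And>b. b \<in> B \<Longrightarrow> \<mu> b \<noteq> 0"
    and V: "span B = V"
    and dF: "\<And>h k t. h \<in> V \<Longrightarrow> k \<in> V \<Longrightarrow>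
      ((\<lambda>t. F (h + t *\<^sub>R k)) has_real_derivative G (h + t *\<^sub>R k) \<bullet> k) (at t)"
    and F0: "F 0 = 0"
    and GL: "\<And>\<epsilon>. \<epsilon> > 0 \<Longrightarrow> \<exists>\<delta>>0. \<forall>h\<in>V. norm h < \<delta> \<longrightarrow> norm (G h - L h) \<le> \<epsilon> * norm h"
  defines "N \<equiv> {b \<in> B. \<mu> b < 0}"
  shows "\<exists>e>0. \<exists>P. finite P \<and> P \<subseteq> {h \<in> V. F h < 0} \<and>
    card P \<le> (if N = {} then 0 else if card N = 1 then 2 else 1) \<and>
    (\<forall>h\<in>V. norm h < e \<longrightarrow> F h < 0 \<longrightarrow> (\<exists>p\<in>P. path_component {h \<in> V. F h < 0} h p))"
proof -
  interpret L: linear L by fact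
  let ?S = "{h \<in> V. F h < 0}"
  \<comment> \<open>Spectral bounds from below and above. The inserted 1 makes \<open>Min\<close>
    and \<open>Max\<close> meaningful for empty B and gives \<beta> \<le> 1 \<le> \<Lambda>.\<close>
  define \<beta> where "\<beta> = Min (insert 1 ((\<lambda>b. \<bar>\<mu> b\<bar>) ` B))"
  define \<Lambda> where "\<Lambda> = Max (insert 1 ((\<lambda>b. \<bar>\<mu> b\<bar>) ` B))"
  have \<beta>: "0 < \<beta>" "\<beta> \<le> 1" using B \<mu>0 by (auto simp: \<beta>_def)
  have \<Lambda>: "1 \<le> \<Lambda>" using B by (auto simp: \<Lambda>_def)
  have \<mu>: "\<beta> \<le> \<bar>\<mu> b\<bar>" "\<bar>\<mu> b\<bar> \<le> \<Lambda>" if "b \<in> B" for b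
    using B that by (auto simp: \<beta>_def \<Lambda>_def intro!: Min_le Max_ge)
  \<comment> \<open>The error allowed in the linear approximation of G. It is chosen so small that
    \<epsilon> \<le> \<beta> / 4 and that the cubic inequality \<open>\<epsilon>3\<close> holds,
    which decides the monotonicity in \<open>expand\<close>.\<close>
  define \<epsilon> where "\<epsilon> = \<beta>\<^sup>2 / (4 * \<Lambda>)"
  have \<epsilon>\<Lambda>: "\<epsilon> * \<Lambda> = \<beta>\<^sup>2 / 4" using \<Lambda> by (simp add: \<epsilon>_def)
  have \<epsilon>: "0 < \<epsilon>" "\<epsilon> \<le> \<beta> / 4"
  proof -
    show "0 < \<epsilon>" using \<beta> \<Lambda> by (simp add: \<epsilon>_def)
    have "\<beta> * \<beta> \<le> \<beta> * \<Lambda>" using \<beta> \<Lambda> by (intro mult_left_mono) auto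
    then show "\<epsilon> \<le> \<beta> / 4" using \<Lambda> by (simp add: \<epsilon>_def field_simps power2_eq_square)
  qed
  have \<epsilon>3: "(\<Lambda> + \<epsilon>) * \<epsilon>\<^sup>2 \<le> (\<beta> - \<epsilon>) ^ 3"
  proof -
    have "(\<Lambda> + \<epsilon>) * \<epsilon>\<^sup>2 = \<epsilon> * (\<epsilon> * \<Lambda>) + \<epsilon> ^ 3"
      by (simp add: power2_eq_square power3_eq_cube algebra_simps)
    also have "\<dots> = \<epsilon> * (\<beta>\<^sup>2 / 4) + \<epsilon> ^ 3" by (simp only: \<epsilon>\<Lambda>)
    also have "\<dots> \<le> \<beta> / 4 * (\<beta>\<^sup>2 / 4) + (\<beta> / 4) ^ 3"
      using \<epsilon> by (intro add_mono mult_right_mono power_mono) auto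
    also have "\<dots> \<le> (3 * \<beta> / 4) ^ 3" using \<beta> by (simp add: field_simps power2_eq_square power3_eq_cube)
    also have "\<dots> \<le> (\<beta> - \<epsilon>) ^ 3" using \<epsilon> \<beta> by (intro power_mono) auto
    finally show ?thesis .
  qed
  obtain \<delta> where \<delta>: "\<delta> > 0" and G: "\<And>h. h \<in> V \<Longrightarrow> norm h < \<delta> \<Longrightarrow> norm (G h - L h) \<le> \<epsilon> * norm h"
    using GL[OF \<epsilon>(1)] by blast
  have subV: "subspace V" using V by (metis subspace_span)
  let ?Vm = "span N" and ?Vp = "span (B - N)"
  have NB: "N \<subseteq> B" by (auto simp: N_def)
  have finN: "finite N" "finite (B - N)" using NB B by (auto intro: finite_subset)
  have ortN: "pairwise orthogonal N" "pairwise orthogonal (B - N)"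
    using B(2) NB by (auto intro: pairwise_subset)
  have eigN: "\<And>b. b \<in> N \<Longrightarrow> norm b = 1 \<and> L b = \<mu> b *\<^sub>R b" "\<And>b. b \<in> B - N \<Longrightarrow> norm b = 1 \<and> L b = \<mu> b *\<^sub>R b"
    using NB eig by auto
  have sub: "?Vm \<subseteq> V" "?Vp \<subseteq> V" using NB V span_mono[of N B] span_mono[of "B - N" B] by auto
  have m: "L u \<in> ?Vm" "L u \<bullet> u = (\<Sum>b\<in>N. \<mu> b * (u \<bullet> b)\<^sup>2)" "u \<bullet> u = (\<Sum>b\<in>N. (u \<bullet> b)\<^sup>2)"
    if "u \<in> ?Vm" for u
    using eigenbasis_span[OF L finN(1) ortN(1) _ that] eigN(1) by blast+
  have p: "L u \<in> ?Vp" "L u \<bullet> u = (\<Sum>b\<in>B - N. \<mu> b * (u \<bullet> b)\<^sup>2)" "u \<bullet> u = (\<Sum>b\<in>B - N. (u \<bullet> b)\<^sup>2)"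
    if "u \<in> ?Vp" for u
    using eigenbasis_span[OF L finN(2) ortN(2) _ that] eigN(2) by blast+
  have split: "\<exists>u\<in>?Vm. \<exists>w\<in>?Vp. h = u + w" if "h \<in> V" for h
  proof -
    have "N \<union> (B - N) = B" using NB by blast
    then have "h \<in> span (N \<union> (B - N))" using that V by simp
    then show ?thesis unfolding span_Un by auto
  qed
  have orth: "u \<bullet> w = 0" if "u \<in> ?Vm" "w \<in> ?Vp" for u w
  proof -
    have "orthogonal w b" if "b \<in> N" for b
    proof -
      have "orthogonal b c" if "c \<in> B - N" for c
        using B(2) NB that \<open>b \<in> N\<close> by (auto simp: pairwise_def)
      then show ?thesis using orthogonal_to_span[OF \<open>w \<in> ?Vp\<close>] orthogonal_commute by blast
    qed
    then have "orthogonal w u" by (rule orthogonal_to_span[OF \<open>u \<in> ?Vm\<close>])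
    then show ?thesis by (simp only: orthogonal_def inner_commute)
  qed
  have Vm: "L u \<bullet> u \<le> - \<beta> * (u \<bullet> u)" "- \<Lambda> * (u \<bullet> u) \<le> L u \<bullet> u" if "u \<in> ?Vm" for u
  proof -
    have "\<mu> b * (u \<bullet> b)\<^sup>2 \<le> - \<beta> * (u \<bullet> b)\<^sup>2 \<and> - \<Lambda> * (u \<bullet> b)\<^sup>2 \<le> \<mu> b * (u \<bullet> b)\<^sup>2" if "b \<in> N" for b
      using \<mu>[of b] that by (intro conjI mult_right_mono) (auto simp: N_def)
    then show "L u \<bullet> u \<le> - \<beta> * (u \<bullet> u)" "- \<Lambda> * (u \<bullet> u) \<le> L u \<bullet> u"
      unfolding m(2,3)[OF that] by (auto simp: sum_distrib_left sum_negf[symmetric] intro!: sum_mono)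
  qed
  have Vp: "\<beta> * (u \<bullet> u) \<le> L u \<bullet> u" "L u \<bullet> u \<le> \<Lambda> * (u \<bullet> u)" if "u \<in> ?Vp" for u
  proof -
    have "\<beta> * (u \<bullet> b)\<^sup>2 \<le> \<mu> b * (u \<bullet> b)\<^sup>2 \<and> \<mu> b * (u \<bullet> b)\<^sup>2 \<le> \<Lambda> * (u \<bullet> b)\<^sup>2" if "b \<in> B - N" for b
      using \<mu>[of b] that by (intro conjI mult_right_mono) (auto simp: N_def)
    then show "\<beta> * (u \<bullet> u) \<le> L u \<bullet> u" "L u \<bullet> u \<le> \<Lambda> * (u \<bullet> u)"
      unfolding p(2,3)[OF that] by (auto simp: sum_distrib_left intro!: sum_mono)
  qed
  have LL: "L (u + w) \<bullet> (u + w) = L u \<bullet> u + L w \<bullet> w" "(norm (u + w))\<^sup>2 = u \<bullet> u + w \<bullet> w"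
    if "u \<in> ?Vm" "w \<in> ?Vp" for u w
  proof -
    have "L u \<bullet> w = 0" "u \<bullet> L w = 0" "u \<bullet> w = 0" using m(1) p(1) that by (auto intro!: orth)
    then show "L (u + w) \<bullet> (u + w) = L u \<bullet> u + L w \<bullet> w" "(norm (u + w))\<^sup>2 = u \<bullet> u + w \<bullet> w"
      by (auto simp: L.add inner_simps inner_commute power2_norm_eq_inner)
  qed
  \<comment> \<open>The mean value theorem on the ray through h gives F h = G (\<theta> h) \<bullet>
    h, which is compared with \<theta> (L h \<bullet> h). The unknown \<theta> scales both the main
    term and the error, so it drops out of all questions about the sign of F.\<close>
  have FL: "\<exists>\<theta>>0. \<bar>F h - \<theta> * (L h \<bullet> h)\<bar> \<le> \<theta> * (\<epsilon> * (norm h)\<^sup>2)" if h: "h \<in> V" "norm h < \<delta>" for h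
  proof -
    obtain \<theta> where \<theta>: "0 < \<theta>" "\<theta> < 1" and eq: "F (0 + 1 *\<^sub>R h) - F (0 + 0 *\<^sub>R h) = (1 - 0) * (G (0 + \<theta> *\<^sub>R h) \<bullet> h)"
      using MVT2[of 0 1 "\<lambda>t. F (0 + t *\<^sub>R h)" "\<lambda>t. G (0 + t *\<^sub>R h) \<bullet> h"] dF[of 0 h] subV h
      by (auto simp: subspace_0)
    have "norm (\<theta> *\<^sub>R h) \<le> norm h" using \<theta> mult_left_le_one_le[of "norm h" \<theta>] by simp
    then have "norm (G (\<theta> *\<^sub>R h) - L (\<theta> *\<^sub>R h)) \<le> \<epsilon> * norm (\<theta> *\<^sub>R h)"
      using h subV by (intro G) (auto simp: subspace_scale)
    then have "norm (G (\<theta> *\<^sub>R h) - \<theta> *\<^sub>R L h) * norm h \<le> (\<epsilon> * (\<theta> * norm h)) * norm h"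
      using \<theta> by (intro mult_right_mono) (auto simp: L.scaleR)
    moreover have "\<bar>(G (\<theta> *\<^sub>R h) - \<theta> *\<^sub>R L h) \<bullet> h\<bar> \<le> norm (G (\<theta> *\<^sub>R h) - \<theta> *\<^sub>R L h) * norm h"
      by (rule Cauchy_Schwarz_ineq2)
    moreover have "(G (\<theta> *\<^sub>R h) - \<theta> *\<^sub>R L h) \<bullet> h = F h - \<theta> * (L h \<bullet> h)"
      using eq F0 by (simp add: inner_diff_left)
    ultimately have "\<bar>F h - \<theta> * (L h \<bullet> h)\<bar> \<le> \<theta> * (\<epsilon> * (norm h)\<^sup>2)"
      by (simp add: power2_eq_square mult_ac)
    then show ?thesis using \<theta> by blast
  qed
  \<comment> \<open>\<open>neg1\<close> and \<open>neg2\<close> enclose the negative set between two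
    cones around the negative eigenspace; u is the negative and w the positive component.\<close>
  have neg1: "(\<beta> - \<epsilon>) * (w \<bullet> w) < (\<Lambda> + \<epsilon>) * (u \<bullet> u)"
    if "u \<in> ?Vm" "w \<in> ?Vp" "norm (u + w) < \<delta>" "F (u + w) < 0" for u w
  proof -
    have uwV: "u + w \<in> V" using that(1,2) sub subspace_add[OF subV] by blast
    note FL' = FL[OF uwV that(3)]
    then obtain \<theta> where \<theta>: "\<theta> > 0"
      and "\<bar>F (u + w) - \<theta> * (L (u + w) \<bullet> (u + w))\<bar> \<le> \<theta> * (\<epsilon> * (norm (u + w))\<^sup>2)"
      by blast
    then have "\<theta> * (L (u + w) \<bullet> (u + w)) < \<theta> * (\<epsilon> * (norm (u + w))\<^sup>2)" using that by linarith
    then have "L u \<bullet> u + L w \<bullet> w < \<epsilon> * (u \<bullet> u + w \<bullet> w)" using \<theta> LL[OF that(1,2)] by simp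
    then show ?thesis using Vm(2)[OF that(1)] Vp(1)[OF that(2)] by (simp add: algebra_simps)
  qed
  have neg2: "F (u + w) < 0"
    if "u \<in> ?Vm" "w \<in> ?Vp" "norm (u + w) < \<delta>" "(\<Lambda> + \<epsilon>) * (w \<bullet> w) < (\<beta> - \<epsilon>) * (u \<bullet> u)" for u w
  proof -
    have uwV: "u + w \<in> V" using that(1,2) sub subspace_add[OF subV] by blast
    note FL' = FL[OF uwV that(3)]
    then obtain \<theta> where \<theta>: "\<theta> > 0"
      and *: "\<bar>F (u + w) - \<theta> * (L (u + w) \<bullet> (u + w))\<bar> \<le> \<theta> * (\<epsilon> * (norm (u + w))\<^sup>2)"
      by blast
    have "L u \<bullet> u + L w \<bullet> w + \<epsilon> * (u \<bullet> u + w \<bullet> w) < 0"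
      using Vm(1)[OF that(1)] Vp(2)[OF that(2)] that(4) by (simp add: algebra_simps)
    then have "\<theta> * (L (u + w) \<bullet> (u + w) + \<epsilon> * (norm (u + w))\<^sup>2) < 0"
      using \<theta> LL[OF that(1,2)] by (simp add: mult_less_0_iff)
    then show ?thesis using * by (simp add: distrib_left)
  qed
  \<comment> \<open>Along s the slope in direction u is at most \<open>norm u * (\<epsilon> * norm w
    - s * ((\<beta> - \<epsilon>) * norm u))\<close>. The outer cone of \<open>neg1\<close> makes
    the bracket nonpositive for s at least 1, so F keeps decreasing while u is scaled up.\<close>
  have expand: "F (w + t *\<^sub>R u) < 0"
    if u: "u \<in> ?Vm" and w: "w \<in> ?Vp" and t: "1 \<le> t" "norm w + t * norm u < \<delta>" and Fuw: "F (w + 1 *\<^sub>R u) < 0"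
    for u w t
  proof -
    have uV: "u \<in> V" "w \<in> V" using u w sub by auto
    have bound: "norm (w + s *\<^sub>R u) < \<delta>" if "1 \<le> s" "s \<le> t" for s
    proof -
      have "norm (w + s *\<^sub>R u) \<le> norm w + s * norm u" using norm_triangle_ineq[of w "s *\<^sub>R u"] that by simp
      also have "\<dots> \<le> norm w + t * norm u" using that by (simp add: mult_right_mono)
      finally show ?thesis using t by linarith
    qed
    have "(\<beta> - \<epsilon>) * (w \<bullet> w) < (\<Lambda> + \<epsilon>) * (u \<bullet> u)"
      using neg1[OF u w] bound[of 1] Fuw t by (simp add: add.commute)
    then have A: "(\<beta> - \<epsilon>) * (norm w)\<^sup>2 < (\<Lambda> + \<epsilon>) * (norm u)\<^sup>2" by (simp add: power2_norm_eq_inner)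
    \<comment> \<open>If this failed, squaring and applying \<open>\<epsilon>3\<close> would
      contradict the cone bound A.\<close>
    have key: "\<epsilon> * norm w \<le> (\<beta> - \<epsilon>) * norm u"
    proof (rule ccontr)
      assume "\<not> ?thesis"
      then have "((\<beta> - \<epsilon>) * norm u)\<^sup>2 \<le> (\<epsilon> * norm w)\<^sup>2" using \<epsilon> \<beta> by (intro power_mono) auto
      then have "(\<Lambda> + \<epsilon>) * ((\<beta> - \<epsilon>) * norm u)\<^sup>2 \<le> (\<Lambda> + \<epsilon>) * (\<epsilon> * norm w)\<^sup>2"
        using \<epsilon> \<Lambda> by (intro mult_left_mono) auto
      also have "\<dots> = ((\<Lambda> + \<epsilon>) * \<epsilon>\<^sup>2) * (norm w)\<^sup>2" by (simp add: power_mult_distrib)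
      also have "\<dots> \<le> (\<beta> - \<epsilon>) ^ 3 * (norm w)\<^sup>2" by (intro mult_right_mono \<epsilon>3) auto
      also have "\<dots> = (\<beta> - \<epsilon>)\<^sup>2 * ((\<beta> - \<epsilon>) * (norm w)\<^sup>2)" by (simp add: power2_eq_square power3_eq_cube)
      also have "\<dots> < (\<beta> - \<epsilon>)\<^sup>2 * ((\<Lambda> + \<epsilon>) * (norm u)\<^sup>2)" using A \<epsilon> \<beta> by (intro mult_strict_left_mono) auto
      finally show False by (simp add: power_mult_distrib mult_ac)
    qed
    have "F (w + t *\<^sub>R u) \<le> F (w + 1 *\<^sub>R u)"
    proof (rule DERIV_nonpos_imp_nonincreasing[OF t(1)])
      fix s assume s: "1 \<le> s" "s \<le> t"
      let ?h = "w + s *\<^sub>R u"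
      have hV: "?h \<in> V" using uV subV by (simp add: subspace_add subspace_scale)
      have "G ?h \<bullet> u = L ?h \<bullet> u + (G ?h - L ?h) \<bullet> u" by (simp add: inner_diff_left)
      also have "(G ?h - L ?h) \<bullet> u \<le> norm (G ?h - L ?h) * norm u" by (rule norm_cauchy_schwarz)
      also have "\<dots> \<le> (\<epsilon> * norm ?h) * norm u" by (intro mult_right_mono G hV bound s) auto
      also have "\<dots> \<le> (\<epsilon> * (norm w + s * norm u)) * norm u"
        using \<epsilon> s norm_triangle_ineq[of w "s *\<^sub>R u"] by (intro mult_right_mono mult_left_mono) auto
      also have "L ?h \<bullet> u = s * (L u \<bullet> u)"
        using orth[OF u p(1)[OF w]] by (simp add: L.add L.scaleR inner_add_left inner_add_right inner_commute[of _ u])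
      also have "\<dots> \<le> s * (- \<beta> * (u \<bullet> u))" using Vm(1)[OF u] s by (intro mult_left_mono) auto
      also have "s * (- \<beta> * (u \<bullet> u)) + (\<epsilon> * (norm w + s * norm u)) * norm u
         = norm u * (\<epsilon> * norm w - s * ((\<beta> - \<epsilon>) * norm u))"
        by (simp add: dot_square_norm power2_eq_square algebra_simps)
      also have "\<dots> \<le> 0"
      proof -
        have "(\<beta> - \<epsilon>) * norm u \<le> s * ((\<beta> - \<epsilon>) * norm u)"
          using s \<epsilon> \<beta> mult_right_mono[of 1 s "(\<beta> - \<epsilon>) * norm u"] by simp
        then show ?thesis using key by (intro mult_nonneg_nonpos) auto
      qed
      finally have "G ?h \<bullet> u \<le> 0" by simp
      then show "\<exists>y. ((\<lambda>t. F (w + t *\<^sub>R u)) has_real_derivative y) (at s) \<and> y \<le> 0"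
        using dF[OF uV(2,1), of s] by blast
    qed
    then show ?thesis using Fuw by linarith
  qed
  have punct: "u \<in> ?S" if "u \<in> ?Vm" "u \<noteq> 0" "norm u < \<delta>" for u
    using neg2[of u 0] that sub \<epsilon> \<beta> by (auto simp: span_zero)
  define \<rho> where "\<rho> = \<delta> / 4"
  have \<rho>: "0 < \<rho>" "4 * \<rho> = \<delta>" using \<delta> by (auto simp: \<rho>_def)
  \<comment> \<open>Small enough, by \<open>e2\<close>, that once u has norm \<rho> every w of norm
    below e lies in the inner cone of \<open>neg2\<close> and can be shrunk to 0. The choice \<rho>
    = \<delta> / 4 keeps all these points within \<delta>.\<close>
  define e where "e = \<rho> * ((\<beta> - \<epsilon>) / (\<Lambda> + \<epsilon>)) / 2"
  have \<kappa>: "0 < (\<beta> - \<epsilon>) / (\<Lambda> + \<epsilon>)" "(\<beta> - \<epsilon>) / (\<Lambda> + \<epsilon>) \<le> 1" using \<epsilon> \<beta> \<Lambda> by (auto simp: field_simps)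
  have e: "0 < e" "e \<le> \<rho>"
  proof -
    show "0 < e" unfolding e_def using mult_pos_pos[OF \<rho>(1) \<kappa>(1)] by (rule half_gt_zero)
    have "\<rho> * ((\<beta> - \<epsilon>) / (\<Lambda> + \<epsilon>)) \<le> \<rho> * 1" using \<rho> \<kappa> by (intro mult_left_mono) auto
    moreover have "a / 2 \<le> \<rho>" if "a \<le> \<rho> * 1" for a using that \<rho>(1) by simp
    ultimately show "e \<le> \<rho>" unfolding e_def by blast
  qed
  have e2: "(\<Lambda> + \<epsilon>) * e\<^sup>2 \<le> (\<beta> - \<epsilon>) * \<rho>\<^sup>2"
  proof -
    have "(\<Lambda> + \<epsilon>) * e\<^sup>2 = ((\<Lambda> + \<epsilon>) * e) * e" by (simp add: power2_eq_square)
    also have "(\<Lambda> + \<epsilon>) * e = \<rho> * (\<beta> - \<epsilon>) / 2"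
    proof -
      have "c * (\<rho> * (a / c) / 2) = \<rho> * a / 2" if "c \<noteq> 0" for a c :: real using that by simp
      moreover have "\<Lambda> + \<epsilon> \<noteq> 0" using \<epsilon> \<Lambda> by linarith
      ultimately show ?thesis unfolding e_def by blast
    qed
    also have "\<dots> * e \<le> \<rho> * (\<beta> - \<epsilon>) / 2 * \<rho>" using e \<rho> \<epsilon> \<beta> by (intro mult_left_mono) auto
    also have "\<dots> \<le> (\<beta> - \<epsilon>) * \<rho>\<^sup>2" using \<rho> \<epsilon> \<beta> by (simp add: power2_eq_square)
    finally show ?thesis .
  qed
  \<comment> \<open>Two segments: first u is scaled up to norm \<rho> with w fixed, then w is shrunk
    to 0 with u fixed.\<close>
  have reach: "\<exists>a\<in>?Vm. norm a = \<rho> \<and> path_component ?S h a" if h: "h \<in> V" "norm h < e" "F h < 0" for h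
  proof -
    obtain u w where u: "u \<in> ?Vm" and w: "w \<in> ?Vp" and huw: "h = u + w" using split[OF h(1)] by blast
    have "(norm h)\<^sup>2 = (norm u)\<^sup>2 + (norm w)\<^sup>2"
      using LL(2)[OF u w] by (simp add: huw power2_norm_eq_inner)
    then have "(norm u)\<^sup>2 \<le> (norm h)\<^sup>2" "(norm w)\<^sup>2 \<le> (norm h)\<^sup>2" by auto
    then have nu: "norm u < e" and nw: "norm w < e" using h power2_le_imp_le[of _ "norm h"] by fastforce+
    have "u \<noteq> 0"
    proof
      assume "u = 0"
      moreover have "0 \<le> (\<beta> - \<epsilon>) * (w \<bullet> w)" using \<epsilon> \<beta> by simp
      ultimately show False using neg1[OF u w] h e \<rho> by (simp add: huw)
    qed
    define T where "T = \<rho> / norm u"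
    have T: "1 \<le> T" "T * norm u = \<rho>" using \<open>u \<noteq> 0\<close> nu e by (auto simp: T_def field_simps)
    let ?a = "T *\<^sub>R u"
    have a: "?a \<in> ?Vm" "norm ?a = \<rho>" using u T by (auto simp: span_scale)
    have "path_component ?S h (w + ?a)"
    proof (rule path_component_linepath, rule subsetI)
      fix x assume "x \<in> closed_segment h (w + ?a)"
      then obtain s where s: "0 \<le> s" "s \<le> 1" and x: "x = (1 - s) *\<^sub>R h + s *\<^sub>R (w + ?a)"
        by (auto simp: closed_segment_def)
      define t where "t = (1 - s) + s * T"
      have x': "x = w + t *\<^sub>R u" by (simp add: x huw t_def algebra_simps)
      have "s * 1 \<le> s * T" "(1 - s) * 1 \<le> (1 - s) * T" using s T by (auto intro!: mult_left_mono simp del: mult_1_right)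
      then have t: "1 \<le> t" "t \<le> T" by (auto simp: t_def algebra_simps)
      then have "t * norm u \<le> \<rho>" using T(2) mult_right_mono[of t T "norm u"] by simp
      then have "F x < 0" unfolding x' using h nw e \<rho>
        by (intro expand[OF u w t(1)]) (auto simp: huw add.commute)
      moreover have "x \<in> V" using u w sub subV unfolding x' by (auto intro!: subspace_add subspace_scale)
      ultimately show "x \<in> ?S" by simp
    qed
    moreover have "path_component ?S (w + ?a) ?a"
    proof (rule path_component_linepath, rule subsetI)
      fix x assume "x \<in> closed_segment (w + ?a) ?a"
      then obtain s where s: "0 \<le> s" "s \<le> 1" and x: "x = (1 - s) *\<^sub>R (w + ?a) + s *\<^sub>R ?a"
        by (auto simp: closed_segment_def)
      have x': "x = ?a + (1 - s) *\<^sub>R w" by (simp add: x algebra_simps)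
      have sw: "norm ((1 - s) *\<^sub>R w) < e" using s nw mult_left_le_one_le[of "norm w" "1 - s"] by simp
      have "norm x \<le> \<rho> + norm ((1 - s) *\<^sub>R w)" unfolding x' using norm_triangle_ineq[of ?a] a(2) by metis
      then have nx: "norm x < \<delta>" using sw e \<rho> by linarith
      have "(norm ((1 - s) *\<^sub>R w))\<^sup>2 < e\<^sup>2" using sw by (intro power_strict_mono) auto
      then have "(\<Lambda> + \<epsilon>) * (norm ((1 - s) *\<^sub>R w))\<^sup>2 < (\<Lambda> + \<epsilon>) * e\<^sup>2" using \<epsilon> \<Lambda> by (intro mult_strict_left_mono) auto
      then have "(\<Lambda> + \<epsilon>) * (norm ((1 - s) *\<^sub>R w))\<^sup>2 < (\<beta> - \<epsilon>) * (norm ?a)\<^sup>2" using e2 a(2) by simp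
      then have "F x < 0" using neg2[OF a(1) span_scale[OF w] nx[unfolded x']]
        unfolding x' power2_norm_eq_inner by blast
      moreover have "x \<in> V" using u w sub subV unfolding x' by (auto intro!: subspace_add subspace_scale)
      ultimately show "x \<in> ?S" by simp
    qed
    ultimately show ?thesis using a path_component_trans by blast
  qed
  have seg: "path_component ?S a b" if "a \<in> ?Vm" "b \<in> ?Vm" "norm a = \<rho>" "norm b = \<rho>" "a \<noteq> - b" for a b
    using that \<rho> by (intro path_component_sphere_segment[of ?Vm a b \<rho> \<delta>] punct) auto
  consider "N = {}" | v where "N = {v}" | v v' where "v \<in> N" "v' \<in> N" "v \<noteq> v'" by blast
  then show ?thesis
  proof cases
    case 1
    then have "\<not> F h < 0" if "h \<in> V" "norm h < e" for h using reach[OF that] \<rho> by auto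
    then show ?thesis using e 1 by (intro exI[of _ e] conjI exI[of _ "{}"]) auto
  next
    case 2
    let ?P = "{\<rho> *\<^sub>R v, - (\<rho> *\<^sub>R v)}"
    have "norm v = 1" using 2 eigN(1) by auto
    have "\<exists>p\<in>?P. path_component ?S h p" if h: "h \<in> V" "norm h < e" "F h < 0" for h
    proof -
      obtain a where a: "a \<in> ?Vm" "norm a = \<rho>" "path_component ?S h a" using reach[OF h] by blast
      then obtain c where c: "a = c *\<^sub>R v" using 2 by (auto simp: span_singleton)
      then have "\<bar>c\<bar> = \<rho>" using a \<open>norm v = 1\<close> by simp
      then have "a \<in> ?P" using c by (auto simp: abs_if split: if_splits)
      then show ?thesis using a by blast
    qed
    moreover have "v \<in> ?Vm" using 2 by (intro span_base) simp
    then have "\<rho> *\<^sub>R v \<in> ?Vm" "- (\<rho> *\<^sub>R v) \<in> ?Vm" by (simp_all add: span_scale span_neg)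
    then have "\<rho> *\<^sub>R v \<in> ?S" "- (\<rho> *\<^sub>R v) \<in> ?S"
      by (intro punct; use \<rho> \<open>norm v = 1\<close> in force)+
    moreover have "card ?P \<le> 2" by (simp add: card_insert_if)
    ultimately show ?thesis using e 2 by (intro exI[of _ e] conjI exI[of _ ?P]) auto
  next
    case 3
    have nv: "norm v = 1" "norm v' = 1" "v \<bullet> v' = 0"
      using 3 eigN(1) ortN(1) by (auto simp: pairwise_def orthogonal_def)
    have Vm': "\<rho> *\<^sub>R v \<in> ?Vm" "\<rho> *\<^sub>R v' \<in> ?Vm" using 3 by (auto simp: span_scale span_base)
    have ne: "\<rho> *\<^sub>R v \<noteq> - (\<rho> *\<^sub>R v')" "\<rho> *\<^sub>R v' \<noteq> - (\<rho> *\<^sub>R v)" "- (\<rho> *\<^sub>R v) \<noteq> - (\<rho> *\<^sub>R v')"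
    proof -
      have "v \<noteq> - v'" "v \<noteq> v'" using nv by auto
      then show "\<rho> *\<^sub>R v \<noteq> - (\<rho> *\<^sub>R v')" "\<rho> *\<^sub>R v' \<noteq> - (\<rho> *\<^sub>R v)" "- (\<rho> *\<^sub>R v) \<noteq> - (\<rho> *\<^sub>R v')"
        using \<rho> by (auto simp flip: scaleR_minus_right)
    qed
    have "path_component ?S h (\<rho> *\<^sub>R v)" if h: "h \<in> V" "norm h < e" "F h < 0" for h
    proof -
      obtain a where a: "a \<in> ?Vm" "norm a = \<rho>" "path_component ?S h a" using reach[OF h] by blast
      have "path_component ?S a (\<rho> *\<^sub>R v)"
      \<comment> \<open>The antipode of the base point cannot be joined to it by a chord, so the
        path goes through the second eigenvector v'.\<close>
      proof (cases "a = - (\<rho> *\<^sub>R v)")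
        case True
        then have "path_component ?S a (\<rho> *\<^sub>R v')" using a ne nv Vm' \<rho> by (intro seg) auto
        moreover have "path_component ?S (\<rho> *\<^sub>R v') (\<rho> *\<^sub>R v)" using ne nv Vm' \<rho> by (intro seg) auto
        ultimately show ?thesis by (rule path_component_trans)
      qed (use a nv Vm' \<rho> in \<open>auto intro: seg\<close>)
      then show ?thesis using a path_component_trans by blast
    qed
    moreover have "\<rho> *\<^sub>R v \<in> ?S" by (intro punct Vm'; use nv \<rho> in force)
    moreover have "N \<noteq> {}" "card N \<noteq> 1" using 3 by (auto simp: card_1_singleton_iff)
    ultimately show ?thesis using e by (intro exI[of _ e] conjI exI[of _ "{\<rho> *\<^sub>R v}"]) auto
  qed
qed

section \<open>Sublevel sets on sparse vectors\<close>

lemma sparse_vecsI: "I1 y \<subseteq> S \<Longrightarrow> card S \<le> s \<Longrightarrow> y \<in> sparse_vecs s"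
  unfolding sparse_vecs_def l0_norm_def using card_mono[of S "I1 y"] by simp

text \<open>Nonzero entries stay nonzero under perturbations below the smallest of their absolute
  values; the inserted 1 covers x = 0. This makes the segment from x to a nearby feasible y
  feasible, as no coordinate outside \<open>I1 y\<close> is switched on.\<close>

lemma I1_subset_nearby:
  fixes x :: "real ^ 'n::finite"
  shows "\<exists>r>0. \<forall>y. norm (y - x) < r \<longrightarrow> I1 x \<subseteq> I1 y"
proof -
  define r where "r = Min (insert 1 ((\<lambda>i. \<bar>x $ i\<bar>) ` I1 x))"
  have "r > 0" by (auto simp: r_def I1_def)
  moreover have "i \<in> I1 y" if "norm (y - x) < r" "i \<in> I1 x" for y i
  proof -
    have "\<bar>(y - x) $ i\<bar> \<le> norm (y - x)" by (rule component_le_norm_cart)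
    moreover have "r \<le> \<bar>x $ i\<bar>" unfolding r_def using that by (intro Min_le) auto
    ultimately show ?thesis using that by (auto simp: I1_def)
  qed
  ultimately show ?thesis by blast
qed

lemma path_component_translate:
  fixes x :: "'a::real_normed_vector"
  assumes "path_component S a b" "\<And>y. y \<in> S \<Longrightarrow> x + y \<in> T"
  shows "path_component T (x + a) (x + b)"
proof -
  obtain g where g: "path g" "path_image g \<subseteq> S" "pathstart g = a" "pathfinish g = b"
    using assms(1) by (auto simp: path_component_def)
  show ?thesis unfolding path_component_def
    using g assms(2)
    by (intro exI[of _ "(\<lambda>y. x + y) \<circ> g"])
      (auto simp: path_translation_eq path_image_translation pathstart_def pathfinish_def)
qed

lemma path_component_segment:
  fixes a v :: "'a::real_normed_vector"
  assumes "\<And>t. 0 \<le> t \<Longrightarrow> t \<le> 1 \<Longrightarrow> a + t *\<^sub>R v \<in> S"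
  shows "path_component S a (a + v)"
proof (rule path_component_linepath, rule subsetI)
  fix y assume "y \<in> closed_segment a (a + v)"
  then obtain t where "0 \<le> t" "t \<le> 1" "y = (1 - t) *\<^sub>R a + t *\<^sub>R (a + v)"
    by (auto simp: closed_segment_def)
  moreover from this have "y = a + t *\<^sub>R v" by (simp add: algebra_simps)
  ultimately show "y \<in> S" using assms[of t] by metis
qed

locale sparse_problem =
  fixes f :: "real ^ 'n::finite \<Rightarrow> real" and s :: nat
  assumes C2: "C_k 2 f"
begin

definition sublevel :: "real \<Rightarrow> (real ^ 'n) set" where
  "sublevel b = {y \<in> sparse_vecs s. f y < b}"

text \<open>An upper bound m on the number of path components of the strict sublevel set at level f
  x that accumulate at x, given by representatives. The points of P need not be close to x, and the
  connecting paths may leave the neighborhood.\<close>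

definition few_adjacent_components :: "real ^ 'n \<Rightarrow> nat \<Rightarrow> bool" where
  "few_adjacent_components x m \<longleftrightarrow> (\<exists>e>0. \<exists>P. finite P \<and> card P \<le> m \<and> P \<subseteq> sublevel (f x) \<and>
     (\<forall>y \<in> sublevel (f x). norm (y - x) < e \<longrightarrow> (\<exists>p\<in>P. path_component (sublevel (f x)) y p)))"

lemma differentiable_f: "f differentiable_on UNIV"
  and differentiable_partial: "partial_deriv i f differentiable_on UNIV"
  using C2 by (auto simp: numeral_2_eq_2)

lemma continuous_f: "continuous_on UNIV f"
  using differentiable_f by (rule differentiable_imp_continuous_on)

lemma continuous_partial: "continuous_on UNIV (partial_deriv i f)"
  using differentiable_partial by (rule differentiable_imp_continuous_on)

lemma f_less_nearby:
  assumes "f x < b" shows "\<exists>e>0. \<forall>y. norm (y - x) < e \<longrightarrow> f y < b"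
proof -
  have "open {y. f y < b}" using continuous_f by (intro open_Collect_less) auto
  then show ?thesis using assms by (auto simp: open_dist dist_norm)
qed

section \<open>Descent along coordinates with nonzero partial derivative\<close>

definition descent_dir :: "real ^ 'n \<Rightarrow> 'n \<Rightarrow> real ^ 'n" where
  "descent_dir x j = - sgn (partial_deriv j f x) *\<^sub>R axis j 1"

lemma norm_descent_dir: "norm (descent_dir x j) \<le> 1"
  by (simp add: descent_dir_def sgn_real_def)

lemma I1_add_descent_dir: "I1 (y + t *\<^sub>R descent_dir x j) \<subseteq> insert j (I1 y)"
  by (auto simp: I1_def descent_dir_def axis_def)

text \<open>By continuity the partial derivatives for j in A keep their sign near x, so the
  direction fixed at x lowers f from every nearby starting point y.\<close>

lemma descent_radius:
  assumes "\<And>j. j \<in> A \<Longrightarrow> partial_deriv j f x \<noteq> 0"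
  shows "\<exists>r>0. (\<forall>y. norm (y - x) < r \<longrightarrow> I1 x \<subseteq> I1 y) \<and>
    (\<forall>y. norm (y - x) < r \<longrightarrow> (\<forall>j\<in>A. partial_deriv j f y \<noteq> 0)) \<and>
    (\<forall>j\<in>A. \<forall>y t. 0 < t \<longrightarrow> norm (y - x) + t < r \<longrightarrow> f (y + t *\<^sub>R descent_dir x j) < f y)"
proof -
  have "\<exists>r>0. \<forall>y. norm (y - x) < r \<longrightarrow> 0 < sgn (partial_deriv j f x) * partial_deriv j f y" if "j \<in> A" for j
  proof -
    have "open {y. 0 < sgn (partial_deriv j f x) * partial_deriv j f y}"
      using continuous_partial by (intro open_Collect_less continuous_intros) auto
    moreover have "0 < sgn (partial_deriv j f x) * partial_deriv j f x"
      using assms[OF that] by (simp add: sgn_real_def)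
    ultimately show ?thesis by (auto simp: open_dist dist_norm)
  qed
  then obtain R where R: "\<And>j. j \<in> A \<Longrightarrow> R j > 0"
    "\<And>j y. j \<in> A \<Longrightarrow> norm (y - x) < R j \<Longrightarrow> 0 < sgn (partial_deriv j f x) * partial_deriv j f y"
    by metis
  obtain r0 where r0: "r0 > 0" "\<And>y. norm (y - x) < r0 \<Longrightarrow> I1 x \<subseteq> I1 y" using I1_subset_nearby by blast
  define r where "r = Min (insert r0 (R ` A))"
  have r: "r > 0" "r \<le> r0" "\<And>j. j \<in> A \<Longrightarrow> r \<le> R j" using R(1) r0 by (auto simp: r_def)
  have "f (y + t *\<^sub>R descent_dir x j) < f y" if j: "j \<in> A" and t: "0 < t" "norm (y - x) + t < r" for j y t
  proof -
    have "f (y + t *\<^sub>R descent_dir x j) < f (y + 0 *\<^sub>R descent_dir x j)"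
    proof (rule DERIV_neg_imp_decreasing[OF t(1)])
      fix \<tau> assume \<tau>: "0 \<le> \<tau>" "\<tau> \<le> t"
      let ?y = "y + \<tau> *\<^sub>R descent_dir x j"
      have "norm (?y - x) \<le> norm (y - x) + norm (\<tau> *\<^sub>R descent_dir x j)"
        by (metis add_diff_eq diff_add_eq norm_triangle_ineq)
      also have "norm (\<tau> *\<^sub>R descent_dir x j) \<le> \<tau>"
        using \<tau> norm_descent_dir[of x j] by (simp add: mult_left_le)
      finally have "norm (?y - x) < R j" using \<tau> t r(3)[OF j] by linarith
      then have "0 < sgn (partial_deriv j f x) * partial_deriv j f ?y" using R j by blast
      moreover have "(\<Sum>i\<in>UNIV. partial_deriv i f ?y * descent_dir x j $ i)
          = - (sgn (partial_deriv j f x) * partial_deriv j f ?y)"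
        by (simp add: descent_dir_def axis_def if_distrib cong: if_cong)
      ultimately show "\<exists>d. ((\<lambda>t. f (y + t *\<^sub>R descent_dir x j)) has_real_derivative d) (at \<tau>) \<and> d < 0"
        using has_real_derivative_along_line[OF differentiable_f, of y "descent_dir x j" \<tau>]
        by (intro exI conjI) auto
    qed
    then show ?thesis by simp
  qed
  moreover have "partial_deriv j f y \<noteq> 0" if "j \<in> A" "norm (y - x) < r" for j y
    using R(2)[OF that(1), of y] r(3)[OF that(1)] that by auto
  ultimately show ?thesis using r r0(2) by (intro exI[of _ r]) (auto dest: less_le_trans)
qed

text \<open>The path first moves y by \<rho> in the descent direction, which lowers f, and then
  translates y to x with the displacement kept. The second segment ends at the target and never gets
  farther from it than y is from x. All supports lie in \<open>insert j (I1 y)\<close>, whence the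
  cardinality condition.\<close>

lemma descend_to_target:
  assumes I1r: "\<And>y. norm (y - x) < r \<Longrightarrow> I1 x \<subseteq> I1 y"
    and desc: "\<And>j y t. j \<in> A \<Longrightarrow> 0 < t \<Longrightarrow> norm (y - x) + t < r \<Longrightarrow> f (y + t *\<^sub>R descent_dir x j) < f y"
    and \<rho>: "0 < \<rho>" "\<rho> < r"
  shows "\<exists>e>0. \<forall>j\<in>A. \<forall>y. norm (y - x) < e \<longrightarrow> f y < f x \<longrightarrow> card (insert j (I1 y)) \<le> s \<longrightarrow>
    path_component (sublevel (f x)) y (x + \<rho> *\<^sub>R descent_dir x j)"
proof -
  let ?p = "\<lambda>j. x + \<rho> *\<^sub>R descent_dir x j"
  have "f (?p j) < f x" if "j \<in> A" for j using desc[OF that \<rho>(1), of x] \<rho> by simp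
  \<comment> \<open>The target lies strictly below level f x, so a whole ball around it does; e is
    fixed only after \<rho>, to keep the translation inside that ball.\<close>
  then have "\<exists>e>0. \<forall>y. norm (y - ?p j) < e \<longrightarrow> f y < f x" if "j \<in> A" for j
    using f_less_nearby that by blast
  then obtain E where E: "\<And>j. j \<in> A \<Longrightarrow> E j > 0"
     "\<And>j y. j \<in> A \<Longrightarrow> norm (y - ?p j) < E j \<Longrightarrow> f y < f x" by metis
  define e where "e = Min (insert (r - \<rho>) (E ` A))"
  have e: "e > 0" "e \<le> r - \<rho>" "\<And>j. j \<in> A \<Longrightarrow> e \<le> E j" using E(1) \<rho> by (auto simp: e_def)
  have "path_component (sublevel (f x)) y (?p j)"
    if j: "j \<in> A" and y: "norm (y - x) < e" "f y < f x" and c: "card (insert j (I1 y)) \<le> s" for j y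
  proof -
    have Iy: "I1 x \<subseteq> I1 y" using y e \<rho> by (intro I1r) auto
    have "path_component (sublevel (f x)) y (y + \<rho> *\<^sub>R descent_dir x j)"
    proof (rule path_component_segment)
      fix t :: real assume t: "0 \<le> t" "t \<le> 1"
      let ?y = "y + (t * \<rho>) *\<^sub>R descent_dir x j"
      have "t * \<rho> \<le> \<rho>" using t \<rho> by (simp add: mult_left_le_one_le)
      then have "norm (y - x) + t * \<rho> < r" using y e(2) by linarith
      then have "f ?y \<le> f y"
        using desc[OF j, of "t * \<rho>" y] t \<rho>(1) by (cases "t = 0") (auto simp: less_imp_le)
      moreover have "?y \<in> sparse_vecs s" using I1_add_descent_dir c by (rule sparse_vecsI)
      ultimately show "y + t *\<^sub>R \<rho> *\<^sub>R descent_dir x j \<in> sublevel (f x)" using y by (simp add: sublevel_def)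
    qed
    moreover have "path_component (sublevel (f x)) (y + \<rho> *\<^sub>R descent_dir x j) (y + \<rho> *\<^sub>R descent_dir x j + (x - y))"
    proof (rule path_component_segment)
      fix t :: real assume t: "0 \<le> t" "t \<le> 1"
      let ?y = "y + \<rho> *\<^sub>R descent_dir x j + t *\<^sub>R (x - y)"
      have "?y - ?p j = (1 - t) *\<^sub>R (y - x)" by (simp add: algebra_simps)
      then have "norm (?y - ?p j) \<le> norm (y - x)" using t by (simp add: mult_left_le_one_le)
      then have "f ?y < f x" using y e(3)[OF j] by (intro E(2)[OF j]) auto
      moreover have "I1 ?y \<subseteq> insert j (I1 y)"
        using Iy by (auto simp: I1_def descent_dir_def axis_def)
      then have "?y \<in> sparse_vecs s" using c by (rule sparse_vecsI)
      ultimately show "?y \<in> sublevel (f x)" by (simp add: sublevel_def)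
    qed
    ultimately show ?thesis by (simp add: path_component_trans algebra_simps)
  qed
  then show ?thesis using e by blast
qed

text \<open>Here the descent coordinate already belongs to the support, so moving along it costs no
  sparsity and a single target serves all nearby points.\<close>

lemma few_adjacent_nonstationary:
  assumes x: "x \<in> sparse_vecs s" and i: "i \<in> I1 x" "partial_deriv i f x \<noteq> 0"
  shows "few_adjacent_components x 1"
proof -
  obtain r where r: "r > 0" "\<And>y. norm (y - x) < r \<Longrightarrow> I1 x \<subseteq> I1 y"
    "\<And>j y t. j \<in> {i} \<Longrightarrow> 0 < t \<Longrightarrow> norm (y - x) + t < r \<Longrightarrow> f (y + t *\<^sub>R descent_dir x j) < f y"
    using descent_radius[of "{i}" x] i by auto
  define \<rho> where "\<rho> = r / 2"
  have \<rho>: "0 < \<rho>" "\<rho> < r" using r by (auto simp: \<rho>_def)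
  let ?p = "x + \<rho> *\<^sub>R descent_dir x i"
  obtain e where e: "e > 0" "\<And>y. norm (y - x) < e \<Longrightarrow> f y < f x \<Longrightarrow> card (insert i (I1 y)) \<le> s \<Longrightarrow>
    path_component (sublevel (f x)) y ?p"
    using descend_to_target[where A = "{i}", OF r(2,3) \<rho>] by (metis singletonI)
  have "I1 ?p \<subseteq> I1 x" using I1_add_descent_dir[of x \<rho> x i] i by auto
  then have "?p \<in> sparse_vecs s" using x by (intro sparse_vecsI[of _ "I1 x"]) (auto simp: sparse_vecs_def l0_norm_def)
  moreover have "f ?p < f x" using r(3)[of i \<rho> x] \<rho> by simp
  moreover have "path_component (sublevel (f x)) y ?p"
    if "y \<in> sublevel (f x)" "norm (y - x) < min e r" for y
  proof (rule e(2))
    have "insert i (I1 y) = I1 y" using i r(2)[of y] that by auto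
    then show "card (insert i (I1 y)) \<le> s" using that by (simp add: sublevel_def sparse_vecs_def l0_norm_def)
  qed (use that in \<open>auto simp: sublevel_def\<close>)
  ultimately show ?thesis unfolding few_adjacent_components_def
    using e r by (intro exI[of _ "min e r"] conjI exI[of _ "{?p}"]) (auto simp: sublevel_def)
qed

text \<open>Each zero coordinate j of x supplies one target, x moved by \<rho> in its descent
  direction, and every nearby lower point reaches some target; this gives n - k components. The
  second claim merges all targets into one component.\<close>

lemma few_adjacent_inactive:
  assumes x: "l0_norm x < s" and nz: "\<And>j. j \<in> I0 x \<Longrightarrow> partial_deriv j f x \<noteq> 0"
    and s: "s < CARD('n)"
  shows "few_adjacent_components x (CARD('n) - l0_norm x)"
    and "l0_norm x + 2 \<le> s \<or> (\<forall>r>0. \<exists>u\<in>coord_space (I1 x). norm u < r \<and> (\<forall>t. 0 < t \<longrightarrow> t \<le> 1 \<longrightarrow> f (x + t *\<^sub>R u) < f x))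
      \<Longrightarrow> few_adjacent_components x 1"
proof -
  obtain r where r: "r > 0" "\<And>y. norm (y - x) < r \<Longrightarrow> I1 x \<subseteq> I1 y"
    "\<And>j y t. j \<in> I0 x \<Longrightarrow> 0 < t \<Longrightarrow> norm (y - x) + t < r \<Longrightarrow> f (y + t *\<^sub>R descent_dir x j) < f y"
    using descent_radius[of "I0 x" x] nz by auto
  define \<rho> where "\<rho> = r / 3"
  have \<rho>: "0 < \<rho>" "\<rho> < r" "3 * \<rho> = r" using r by (auto simp: \<rho>_def)
  let ?p = "\<lambda>j. x + \<rho> *\<^sub>R descent_dir x j"
  have I0: "I0 x = UNIV - I1 x" by (auto simp: I0_def I1_def)
  then have cardI0: "card (I0 x) = CARD('n) - l0_norm x" by (simp add: card_Diff_subset l0_norm_def)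
  then obtain j0 where j0: "j0 \<in> I0 x" using x s by (metis card.empty diff_is_0_eq ex_in_conv less_trans not_le)
  obtain e where e: "e > 0" "\<And>j y. j \<in> I0 x \<Longrightarrow> norm (y - x) < e \<Longrightarrow> f y < f x \<Longrightarrow> card (insert j (I1 y)) \<le> s \<Longrightarrow>
    path_component (sublevel (f x)) y (?p j)"
    using descend_to_target[where A = "I0 x", OF r(2,3) \<rho>(1,2)] by metis
  have card1: "card (insert j (I1 x)) \<le> s" for j
    using x card_insert_le_m1[of s "I1 x" j] by (auto simp: l0_norm_def)
  have pU: "?p j \<in> sublevel (f x)" if "j \<in> I0 x" for j
    using r(3)[OF that \<rho>(1), of x] \<rho> sparse_vecsI[OF I1_add_descent_dir card1] by (simp add: sublevel_def)
  have reach: "\<exists>j\<in>I0 x. path_component (sublevel (f x)) y (?p j)"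
    if y: "y \<in> sublevel (f x)" "norm (y - x) < min e r" for y
  proof -
    have cy: "card (I1 y) \<le> s" "f y < f x" using y by (auto simp: sublevel_def sparse_vecs_def l0_norm_def)
    \<comment> \<open>If y has room for one more nonzero entry, any zero coordinate of x will do.
      Otherwise y has s > k nonzero entries and already uses some coordinate outside
      \<open>I1 x\<close>, along which it can move without a larger support.\<close>
    obtain j where j: "j \<in> I0 x" "card (insert j (I1 y)) \<le> s"
    proof (cases "card (I1 y) < s")
      case True
      then show ?thesis using that[OF j0] card_insert_le_m1[of s "I1 y" j0] by auto
    next
      case False
      have "I1 x \<noteq> I1 y" using False x by (auto simp: l0_norm_def)
      then obtain j where "j \<in> I1 y" "j \<notin> I1 x" using r(2)[of y] y by auto
      then show ?thesis using that[of j] cy I0 by (simp add: insert_absorb)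
    qed
    then show ?thesis using e(2)[of j y] y cy by auto
  qed
  show "few_adjacent_components x (CARD('n) - l0_norm x)"
    unfolding few_adjacent_components_def
    using e r reach pU card_image_le[of "I0 x" ?p] cardI0
    by (intro exI[of _ "min e r"] conjI exI[of _ "?p ` I0 x"]) auto
  assume H: "l0_norm x + 2 \<le> s \<or> (\<forall>r>0. \<exists>u\<in>coord_space (I1 x). norm u < r \<and> (\<forall>t. 0 < t \<longrightarrow> t \<le> 1 \<longrightarrow> f (x + t *\<^sub>R u) < f x))"
  (* Two targets are joined through a point with two new nonzero coordinates, or, if there is room for only
     one, through a point x + u on the support of x lying below the level of x. *)
  have link: "path_component (sublevel (f x)) (?p j) (?p j')" if j: "j \<in> I0 x" "j' \<in> I0 x" for j j'
    using H
  proof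
    assume k: "l0_norm x + 2 \<le> s"
    have half: "path_component (sublevel (f x)) (?p j) (?p j + \<rho> *\<^sub>R descent_dir x j')"
      if j: "j \<in> I0 x" "j' \<in> I0 x" for j j'
    proof (rule path_component_segment)
      fix t :: real assume t: "0 \<le> t" "t \<le> 1"
      let ?y = "?p j + (t * \<rho>) *\<^sub>R descent_dir x j'"
      have "t * \<rho> \<le> \<rho>" using t \<rho> by (simp add: mult_left_le_one_le)
      moreover have "norm (?p j - x) \<le> \<rho>" using norm_descent_dir[of x j] \<rho> by (simp add: mult_left_le)
      ultimately have "norm (?p j - x) + t * \<rho> < r" using \<rho> by linarith
      then have "f ?y \<le> f (?p j)"
        using r(3)[OF j(2), of "t * \<rho>" "?p j"] t \<rho>(1) by (cases "t = 0") (auto simp: less_imp_le)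
      moreover have "f (?p j) < f x" using pU[OF j(1)] by (simp add: sublevel_def)
      moreover have "I1 ?y \<subseteq> insert j' (insert j (I1 x))"
        using I1_add_descent_dir[of "?p j" "t * \<rho>" x j'] I1_add_descent_dir[of x \<rho> x j] by blast
      moreover have "card (insert j' (insert j (I1 x))) \<le> s"
        using k card_insert_le_m1[of "card (I1 x) + 1" "I1 x" j]
          card_insert_le_m1[of "card (I1 x) + 2" "insert j (I1 x)" j'] by (auto simp: l0_norm_def)
      ultimately show "?p j + t *\<^sub>R \<rho> *\<^sub>R descent_dir x j' \<in> sublevel (f x)"
        using sparse_vecsI by (auto simp: sublevel_def)
    qed
    have "?p j' + \<rho> *\<^sub>R descent_dir x j = ?p j + \<rho> *\<^sub>R descent_dir x j'" by (simp add: algebra_simps)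
    then show ?thesis using half[OF j] half[OF j(2,1)] by (metis path_component_sym path_component_trans)
  next
    assume "\<forall>r>0. \<exists>u\<in>coord_space (I1 x). norm u < r \<and> (\<forall>t. 0 < t \<longrightarrow> t \<le> 1 \<longrightarrow> f (x + t *\<^sub>R u) < f x)"
    then obtain u where u: "u \<in> coord_space (I1 x)" "norm u < \<rho>"
      "\<And>t. 0 < t \<Longrightarrow> t \<le> 1 \<Longrightarrow> f (x + t *\<^sub>R u) < f x" using \<rho>(1) by blast
    have I1u: "I1 (x + t *\<^sub>R u + q *\<^sub>R descent_dir x j) \<subseteq> insert j (I1 x)" for t q j
      using u(1) by (auto simp: I1_def descent_dir_def axis_def coord_space_def)
    have half: "path_component (sublevel (f x)) (x + u) (?p j)" if j: "j \<in> I0 x" for j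
    proof -
      have "path_component (sublevel (f x)) (?p j) (?p j + u)"
      proof (rule path_component_segment)
        fix t :: real assume t: "0 \<le> t" "t \<le> 1"
        have "norm (t *\<^sub>R u) \<le> norm u" using t by (simp add: mult_left_le_one_le)
        then have "f (x + t *\<^sub>R u + \<rho> *\<^sub>R descent_dir x j) < f (x + t *\<^sub>R u)"
          using r(3)[OF j \<rho>(1), of "x + t *\<^sub>R u"] u(2) \<rho> by simp
        moreover have "f (x + t *\<^sub>R u) \<le> f x" using u(3)[of t] t by (cases "t = 0") auto
        ultimately have "x + t *\<^sub>R u + \<rho> *\<^sub>R descent_dir x j \<in> sublevel (f x)"
          using sparse_vecsI[OF I1u card1] by (auto simp: sublevel_def)
        then show "?p j + t *\<^sub>R u \<in> sublevel (f x)" by (simp add: add_ac)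
      qed
      moreover have "path_component (sublevel (f x)) (x + u) (x + u + \<rho> *\<^sub>R descent_dir x j)"
      proof (rule path_component_segment)
        fix t :: real assume t: "0 \<le> t" "t \<le> 1"
        have "t * \<rho> \<le> \<rho>" using t \<rho> by (simp add: mult_left_le_one_le)
        moreover have "norm (x + u - x) < \<rho>" using u(2) by simp
        ultimately have "norm (x + u - x) + t * \<rho> < r" using \<rho> by linarith
        then have "f (x + u + (t * \<rho>) *\<^sub>R descent_dir x j) \<le> f (x + u)"
          using r(3)[OF j, of "t * \<rho>" "x + u"] t \<rho>(1) by (cases "t = 0") (auto simp: less_imp_le)
        moreover have "f (x + u) < f x" using u(3)[of 1] by simp
        ultimately show "x + u + t *\<^sub>R \<rho> *\<^sub>R descent_dir x j \<in> sublevel (f x)"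
          using sparse_vecsI[OF I1u[of 1 "t * \<rho>"] card1] by (auto simp: sublevel_def)
      qed
      moreover have "x + u + \<rho> *\<^sub>R descent_dir x j = ?p j + u" by (simp add: add_ac)
      ultimately show ?thesis by (metis path_component_sym path_component_trans)
    qed
    show ?thesis using half[OF j(1)] half[OF j(2)] path_component_sym path_component_trans by blast
  qed
  show "few_adjacent_components x 1"
    unfolding few_adjacent_components_def
  proof (intro exI[of _ "min e r"] conjI exI[of _ "{?p j0}"] ballI impI)
    fix y assume "y \<in> sublevel (f x)" "norm (y - x) < min e r"
    then show "\<exists>p\<in>{?p j0}. path_component (sublevel (f x)) y p"
      using reach[of y] link j0 path_component_trans by (metis singletonI)
  qed (use e r pU j0 in auto)
qed

section \<open>Hessian and gradient on the support\<close>

text \<open>The matrix \<open>restricted_hessian\<close> as an operator on \<open>real ^ 'n\<close>,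
  with the same order of the two derivatives and zero off the support, so that the spectral lemmas
  for Euclidean spaces apply.\<close>

definition hess :: "real ^ 'n \<Rightarrow> real ^ 'n \<Rightarrow> real ^ 'n" where
  "hess x h = (\<chi> i. if i \<in> I1 x then \<Sum>j\<in>I1 x. partial_deriv i (partial_deriv j f) x * h $ j else 0)"

text \<open>The argument h is the displacement from x; the gradient at x + h is projected onto the
  support of x.\<close>

definition grad :: "real ^ 'n \<Rightarrow> real ^ 'n \<Rightarrow> real ^ 'n" where
  "grad x h = (\<chi> i. if i \<in> I1 x then partial_deriv i f (x + h) else 0)"

lemma linear_hess: "linear (hess x)"
  by (rule linearI) (auto simp: hess_def vec_eq_iff algebra_simps sum.distrib sum_distrib_left)

lemma hess_coord_space: "hess x h \<in> coord_space (I1 x)"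
  by (simp add: hess_def coord_space_def)

lemma hess_selfadjoint:
  assumes "h \<in> coord_space (I1 x)" "k \<in> coord_space (I1 x)"
  shows "hess x h \<bullet> k = h \<bullet> hess x k"
proof -
  let ?H = "\<lambda>i j. partial_deriv i (partial_deriv j f) x"
  have "hess x h \<bullet> k = (\<Sum>i\<in>I1 x. \<Sum>j\<in>I1 x. ?H i j * h $ j * k $ i)"
    unfolding inner_coord_space[OF hess_coord_space] by (simp add: hess_def sum_distrib_right)
  also have "\<dots> = (\<Sum>j\<in>I1 x. \<Sum>i\<in>I1 x. ?H i j * h $ j * k $ i)" by (rule sum.swap)
  also have "\<dots> = (\<Sum>j\<in>I1 x. \<Sum>i\<in>I1 x. h $ j * (?H j i * k $ i))"
    by (intro sum.cong refl) (metis (no_types, lifting) C2 mult.assoc mult.commute partial_deriv_commute)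
  also have "\<dots> = h \<bullet> hess x k"
    unfolding inner_coord_space[OF assms(1)] by (simp add: hess_def sum_distrib_left)
  finally show ?thesis .
qed

text \<open>Everything that nondegeneracy and the quadratic index say about the matrix, translated
  into an orthonormal eigenbasis of the tangent space through the similarity to a diagonal
  matrix.\<close>

lemma hess_eigenbasis:
  assumes "nondegenerate f s x"
  obtains B \<mu> where "finite B" "pairwise orthogonal B" "\<And>b. b \<in> B \<Longrightarrow> norm b = 1 \<and> hess x b = \<mu> b *\<^sub>R b"
    "span B = coord_space (I1 x)" "\<And>b. b \<in> B \<Longrightarrow> \<mu> b \<noteq> 0"
    "card {b \<in> B. \<mu> b < 0} = quadratic_index f x"
proof -
  have "\<exists>B \<mu>. finite B \<and> pairwise orthogonal B \<and> (\<forall>b\<in>B. norm b = 1 \<and> hess x b = \<mu> b *\<^sub>R b) \<and>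
      span B = coord_space (I1 x)"
    by (intro selfadjoint_eigenbasis linear_hess subspace_coord_space hess_coord_space hess_selfadjoint)
  then obtain B \<mu> where B: "finite B" "pairwise orthogonal B" "\<And>b. b \<in> B \<Longrightarrow> norm b = 1 \<and> hess x b = \<mu> b *\<^sub>R b"
    "span B = coord_space (I1 x)" by blast
  define k where "k = card (I1 x)"
  have "0 \<notin> B" using B(3) by fastforce
  then have "independent B" using B(2) by (intro pairwise_orthogonal_independent)
  then have "card B = dim (span B)" by (simp add: dim_eq_card_independent)
  then have cardB: "card B = k" unfolding B(4) k_def by (simp only: dim_coord_space)
  obtain g where g: "bij_betw g {..<k} B"
    using ex_bij_betw_nat_finite[OF B(1)] cardB by (auto simp: atLeast0LessThan)
  have e: "bij_betw (from_nat_into (I1 x)) {..<k} (I1 x)"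
    unfolding k_def by (rule bij_betw_from_nat_into_finite) simp
  have Bsub: "B \<subseteq> coord_space (I1 x)" using B(4) span_superset by blast
  have eig: "(\<Sum>j\<in>I1 x. partial_deriv i (partial_deriv j f) x * b $ j) = \<mu> b * b $ i"
    if b: "b \<in> B" and i: "i \<in> I1 x" for b i
  proof -
    have "hess x b $ i = (\<mu> b *\<^sub>R b) $ i" using B(3)[OF b] by simp
    then show ?thesis using i by (simp add: hess_def)
  qed
  have "similar_mat (restricted_hessian f x) (mat_diag k (\<lambda>c. \<mu> (g c)))"
    using similar_mat_diag_of_eigenbasis[OF e[unfolded k_def] g[unfolded k_def] B(2) _ Bsub eig] B(3)
    by (simp add: restricted_hessian_def k_def Let_def)
  note sim = num_neg_eigenvalues_mat_diag[OF this]
  have gB: "B = g ` {..<k}" using g by (simp add: bij_betw_def)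
  have "quadratic_index f x = card {c. c < k \<and> \<mu> (g c) < 0}"
    using sim(1) by (simp add: quadratic_index_def)
  also have "\<dots> = card (g ` {c. c < k \<and> \<mu> (g c) < 0})"
    using g by (intro card_image[symmetric]) (auto simp: bij_betw_def inj_on_def)
  also have "g ` {c. c < k \<and> \<mu> (g c) < 0} = {b \<in> B. \<mu> b < 0}" unfolding gB by auto
  finally have "card {b \<in> B. \<mu> b < 0} = quadratic_index f x" by simp
  moreover have "\<mu> b \<noteq> 0" if "b \<in> B" for b
    using sim(2) assms that by (auto simp: nondegenerate_def gB)
  ultimately show thesis using that B by blast
qed

text \<open>Differentiability of each first partial derivative at x; M-stationarity removes the
  constant term on the support.\<close>

lemma grad_hess_approx:
  assumes "M_stationary f s x" and \<epsilon>: "\<epsilon> > 0"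
  shows "\<exists>\<delta>>0. \<forall>h\<in>coord_space (I1 x). norm h < \<delta> \<longrightarrow> norm (grad x h - hess x h) \<le> \<epsilon> * norm h"
proof -
  \<comment> \<open>The norm is bounded by the sum of the \<open>CARD('n)\<close> component errors,
    so each may use this share of \<epsilon>.\<close>
  define \<eta> where "\<eta> = \<epsilon> / CARD('n)"
  have \<eta>: "\<eta> > 0" using \<epsilon> by (simp add: \<eta>_def)
  define E where "E i y = norm (partial_deriv i f y - partial_deriv i f x
       - (\<Sum>j\<in>UNIV. partial_deriv j (partial_deriv i f) x * (y - x) $ j))" for i y
  have "\<exists>d>0. \<forall>y. norm (y - x) < d \<longrightarrow> E i y \<le> \<eta> * norm (y - x)" for i
    using has_derivative_partial_deriv[OF differentiable_partial, of i x] \<eta>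
    unfolding has_derivative_at_alt E_def by blast
  then obtain d where d: "\<And>i. d i > 0" "\<And>i y. norm (y - x) < d i \<Longrightarrow> E i y \<le> \<eta> * norm (y - x)"
    by metis
  define \<delta> where "\<delta> = Min (range d)"
  have \<delta>: "\<delta> > 0" "\<And>i. \<delta> \<le> d i" using d(1) by (auto simp: \<delta>_def)
  have "norm (grad x h - hess x h) \<le> \<epsilon> * norm h" if h: "h \<in> coord_space (I1 x)" "norm h < \<delta>" for h
  proof -
    have comp: "\<bar>(grad x h - hess x h) $ i\<bar> \<le> \<eta> * norm h" for i
    proof (cases "i \<in> I1 x")
      case True
      have "(\<Sum>j\<in>UNIV. partial_deriv j (partial_deriv i f) x * h $ j)
          = (\<Sum>j\<in>I1 x. partial_deriv j (partial_deriv i f) x * h $ j)"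
        using h(1) by (intro sum.mono_neutral_right) (auto simp: coord_space_def)
      \<comment> \<open>Differentiating \<open>partial_deriv i f\<close> puts the derivatives in the
        order opposite to \<open>hess\<close>, so their symmetry is used.\<close>
      also have "\<dots> = hess x h $ i"
        using True by (simp add: hess_def partial_deriv_commute[OF C2, of i])
      finally have "(\<Sum>j\<in>UNIV. partial_deriv j (partial_deriv i f) x * h $ j) = hess x h $ i" .
      moreover have "partial_deriv i f x = 0" using assms True by (simp add: M_stationary_def)
      ultimately show ?thesis using d(2)[of "x + h" i] \<delta>(2)[of i] h(2) True by (simp add: grad_def E_def)
    next
      case False
      then show ?thesis using \<eta> by (simp add: grad_def hess_def)
    qed
    have "norm (grad x h - hess x h) \<le> (\<Sum>i\<in>UNIV. \<bar>(grad x h - hess x h) $ i\<bar>)" by (rule norm_le_l1_cart)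
    also have "\<dots> \<le> (\<Sum>i\<in>(UNIV :: 'n set). \<eta> * norm h)" by (intro sum_mono comp)
    also have "\<dots> = \<epsilon> * norm h" by (simp add: \<eta>_def)
    finally show ?thesis .
  qed
  then show ?thesis using \<delta>(1) by blast
qed

lemma has_derivative_grad:
  assumes "k \<in> coord_space (I1 x)"
  shows "((\<lambda>t. f (x + (h + t *\<^sub>R k)) - f x) has_real_derivative grad x (h + t *\<^sub>R k) \<bullet> k) (at t)"
proof -
  have "(\<Sum>i\<in>UNIV. partial_deriv i f (x + h + t *\<^sub>R k) * k $ i) = (\<Sum>i\<in>I1 x. partial_deriv i f (x + h + t *\<^sub>R k) * k $ i)"
    using assms by (intro sum.mono_neutral_right) (auto simp: coord_space_def)
  also have "\<dots> = grad x (h + t *\<^sub>R k) \<bullet> k"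
    by (subst inner_coord_space[of _ "I1 x"]) (auto simp: grad_def coord_space_def add.assoc)
  finally have "((\<lambda>t. f (x + h + t *\<^sub>R k)) has_real_derivative grad x (h + t *\<^sub>R k) \<bullet> k) (at t)"
    using has_real_derivative_along_line[OF differentiable_f, of "x + h" k t] by simp
  from DERIV_diff[OF this DERIV_const[of "f x"]] show ?thesis by (simp add: add.assoc)
qed

text \<open>With k = s, a nearby feasible point has a support that contains \<open>I1 x\<close> and
  is no larger, so it equals \<open>I1 x\<close>. Locally the feasible set is therefore x plus
  \<open>coord_space (I1 x)\<close>, and the result for smooth critical points applies.\<close>

lemma few_adjacent_active:
  assumes x: "M_stationary f s x" and nd: "nondegenerate f s x" and k: "l0_norm x = s"
  shows "few_adjacent_components x (if quadratic_index f x = 0 then 0 else if quadratic_index f x = 1 then 2 else 1)"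
proof -
  let ?V = "coord_space (I1 x)" and ?F = "\<lambda>h. f (x + h) - f x"
  let ?m = "if quadratic_index f x = 0 then 0 else if quadratic_index f x = 1 then 2 else (1::nat)"
  obtain B \<mu> where B: "finite B" "pairwise orthogonal B" "\<And>b. b \<in> B \<Longrightarrow> norm b = 1 \<and> hess x b = \<mu> b *\<^sub>R b"
    "span B = ?V" "\<And>b. b \<in> B \<Longrightarrow> \<mu> b \<noteq> 0" and QI: "card {b \<in> B. \<mu> b < 0} = quadratic_index f x"
    by (rule hess_eigenbasis[OF nd]) (rule that)
  have neg: "\<exists>e>0. \<exists>P. finite P \<and> P \<subseteq> {h \<in> ?V. ?F h < 0} \<and>
    card P \<le> (if {b \<in> B. \<mu> b < 0} = {} then 0 else if card {b \<in> B. \<mu> b < 0} = 1 then 2 else 1) \<and>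
    (\<forall>h\<in>?V. norm h < e \<longrightarrow> ?F h < 0 \<longrightarrow> (\<exists>p\<in>P. path_component {h \<in> ?V. ?F h < 0} h p))"
    by (rule negative_set_near_critical_point[where F = ?F and G = "grad x", OF linear_hess B(1,2,3,5,4)])
      (use has_derivative_grad grad_hess_approx[OF x] in auto)
  have QI0: "{b \<in> B. \<mu> b < 0} = {} \<longleftrightarrow> quadratic_index f x = 0"
    unfolding QI[symmetric] using B(1) by (subst card_0_eq) auto
  obtain e P where e: "e > 0" and P: "finite P" "P \<subseteq> {h \<in> ?V. ?F h < 0}" "card P \<le> ?m"
    and path: "\<And>h. h \<in> ?V \<Longrightarrow> norm h < e \<Longrightarrow> ?F h < 0 \<Longrightarrow> \<exists>p\<in>P. path_component {h \<in> ?V. ?F h < 0} h p"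
    using neg[unfolded QI QI0] by blast
  obtain r where r: "r > 0" "\<And>y. norm (y - x) < r \<Longrightarrow> I1 x \<subseteq> I1 y" using I1_subset_nearby by blast
  have sub: "x + h \<in> sublevel (f x)" if "h \<in> {h \<in> ?V. ?F h < 0}" for h
  proof -
    have "I1 (x + h) \<subseteq> I1 x" using that by (auto simp: I1_def coord_space_def)
    then show ?thesis using that k sparse_vecsI[of "x + h" "I1 x" s] by (simp add: sublevel_def l0_norm_def)
  qed
  show ?thesis unfolding few_adjacent_components_def
  proof (intro exI[of _ "min e r"] conjI exI[of _ "(+) x ` P"] ballI impI)
    show "card ((+) x ` P) \<le> ?m" using P card_image_le[of P "(+) x"] by linarith
    fix y assume y: "y \<in> sublevel (f x)" "norm (y - x) < min e r"
    have "I1 x \<subseteq> I1 y" using r(2) y by simp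
    moreover have "card (I1 y) \<le> card (I1 x)" using y k by (simp add: sublevel_def sparse_vecs_def l0_norm_def)
    ultimately have "I1 y = I1 x" by (metis card_subset_eq card_mono finite le_antisym)
    then have "y - x \<in> ?V" by (auto simp: coord_space_def I1_def)
    then obtain p where p: "p \<in> P" "path_component {h \<in> ?V. ?F h < 0} (y - x) p"
      using path[of "y - x"] y by (auto simp: sublevel_def)
    have "path_component (sublevel (f x)) (x + (y - x)) (x + p)"
      by (rule path_component_translate[OF p(2) sub])
    then show "\<exists>q\<in>(+) x ` P. path_component (sublevel (f x)) y q" using p(1) by auto
  qed (use e r P sub in auto)
qed

text \<open>A short multiple of an eigenvector for a negative eigenvalue works: the approximation
  error of the gradient is held to half the size of the eigenvalue, so the slope stays negative.
  This supplies the passage below x required by \<open>few_adjacent_inactive\<close>.\<close>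

lemma negative_direction:
  assumes x: "M_stationary f s x" and nd: "nondegenerate f s x" and q: "quadratic_index f x \<noteq> 0" and r: "r > 0"
  shows "\<exists>u\<in>coord_space (I1 x). norm u < r \<and> (\<forall>t. 0 < t \<longrightarrow> t \<le> 1 \<longrightarrow> f (x + t *\<^sub>R u) < f x)"
proof -
  let ?V = "coord_space (I1 x)"
  obtain B \<mu> where B: "finite B" "pairwise orthogonal B" "\<And>b. b \<in> B \<Longrightarrow> norm b = 1 \<and> hess x b = \<mu> b *\<^sub>R b"
    "span B = ?V" "\<And>b. b \<in> B \<Longrightarrow> \<mu> b \<noteq> 0" and QI: "card {b \<in> B. \<mu> b < 0} = quadratic_index f x"
    by (rule hess_eigenbasis[OF nd]) (rule that)
  obtain b where b: "b \<in> B" "\<mu> b < 0" using q QI by (metis (mono_tags, lifting) Collect_empty_eq card.empty)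
  have nb: "norm b = 1" "b \<bullet> b = 1" "hess x b = \<mu> b *\<^sub>R b" "b \<in> ?V"
    using B(3)[OF b(1)] B(4) span_base[OF b(1)] by (auto simp: norm_eq_1)
  define \<epsilon> where "\<epsilon> = - \<mu> b / 2"
  obtain \<delta> where \<delta>: "\<delta> > 0" "\<And>h. h \<in> ?V \<Longrightarrow> norm h < \<delta> \<Longrightarrow> norm (grad x h - hess x h) \<le> \<epsilon> * norm h"
    using grad_hess_approx[OF x, of \<epsilon>] b(2) by (auto simp: \<epsilon>_def)
  define \<rho> where "\<rho> = min r \<delta> / 2"
  have \<rho>: "\<rho> > 0" "\<rho> < r" "\<rho> < \<delta>" using r \<delta> by (auto simp: \<rho>_def)
  have "f (x + \<tau> *\<^sub>R b) < f x" if \<tau>: "0 < \<tau>" "\<tau> \<le> \<rho>" for \<tau>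
  proof -
    obtain z where z: "0 < z" "z < \<tau>" and eq: "f (x + (0 + \<tau> *\<^sub>R b)) - f x - (f (x + (0 + 0 *\<^sub>R b)) - f x) = (\<tau> - 0) * (grad x (0 + z *\<^sub>R b) \<bullet> b)"
      using MVT2[OF \<tau>(1) has_derivative_grad[OF nb(4), of 0]] by blast
    have "norm (grad x (z *\<^sub>R b) - hess x (z *\<^sub>R b)) \<le> \<epsilon> * z"
      using \<delta>(2)[of "z *\<^sub>R b"] nb z \<tau> \<rho> by (auto simp: subspace_scale[OF subspace_coord_space])
    moreover have "(grad x (z *\<^sub>R b) - hess x (z *\<^sub>R b)) \<bullet> b \<le> norm (grad x (z *\<^sub>R b) - hess x (z *\<^sub>R b)) * norm b"
      by (rule norm_cauchy_schwarz)
    moreover have "hess x (z *\<^sub>R b) = (z * \<mu> b) *\<^sub>R b"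
      using linear_scale[OF linear_hess, of x z b] nb(3) by simp
    then have "hess x (z *\<^sub>R b) \<bullet> b = z * \<mu> b" using nb(2) by simp
    ultimately have "grad x (z *\<^sub>R b) \<bullet> b \<le> z * (\<mu> b + \<epsilon>)"
      using nb(1) by (simp add: inner_diff_left algebra_simps)
    also have "\<dots> < 0" using z b(2) by (simp add: \<epsilon>_def mult_less_0_iff)
    finally have "\<tau> * (grad x (z *\<^sub>R b) \<bullet> b) < 0" using \<tau> by (simp add: mult_less_0_iff)
    then show ?thesis using eq by simp
  qed
  moreover have "0 < t \<Longrightarrow> t \<le> 1 \<Longrightarrow> 0 < t * \<rho> \<and> t * \<rho> \<le> \<rho>" for t
    using \<rho> by (simp add: mult_left_le_one_le)
  ultimately show ?thesis using \<rho> nb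
    by (intro bexI[of _ "\<rho> *\<^sub>R b"]) (auto simp: subspace_scale[OF subspace_coord_space])
qed

lemma few_adjacent_M_stationary:
  assumes x: "M_stationary f s x" and nd: "nondegenerate f s x" and s: "s < CARD('n)"
  shows "few_adjacent_components x
    (1 + (if type_I f s x then 1 else if type_II f s x then CARD('n) - s else 0))"
proof -
  have mono: "few_adjacent_components x m \<Longrightarrow> m \<le> m' \<Longrightarrow> few_adjacent_components x m'" for m m'
    unfolding few_adjacent_components_def by (meson le_trans)
  have k: "l0_norm x \<le> s" using x by (simp add: M_stationary_def sparse_vecs_def)
  show ?thesis
  proof (cases "l0_norm x = s")
    case True
    have "quadratic_index f x = 1 \<Longrightarrow> type_I f s x" using True x nd by (simp add: type_I_def M_index_def)
    then show ?thesis by (intro mono[OF few_adjacent_active[OF x nd True]]) auto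
  next
    case False
    then have l: "l0_norm x < s" using k by simp
    note inact = few_adjacent_inactive[OF l _ s]
    have nz: "\<And>j. j \<in> I0 x \<Longrightarrow> partial_deriv j f x \<noteq> 0" using nd l by (simp add: nondegenerate_def)
    have I: "\<not> type_I f s x" using False by (simp add: type_I_def)
    show ?thesis
    proof (cases "type_II f s x")
      case True
      then have "CARD('n) - l0_norm x = 1 + (CARD('n) - s)" using s by (auto simp: type_II_def)
      then show ?thesis using I True inact(1)[OF nz] by simp
    next
      case II: False
      \<comment> \<open>With k < s, the only case excluded by both alternatives is k = s - 1 with
        quadratic index 0, which is type (II).\<close>
      have "l0_norm x + 2 \<le> s \<or> quadratic_index f x \<noteq> 0"
        using II l x nd by (auto simp: type_II_def M_index_def)
      then have "few_adjacent_components x 1"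
        using negative_direction[OF x nd] by (intro inact(2)[OF nz]) auto
      then show ?thesis using I II by simp
    qed
  qed
qed

lemma few_adjacent_components_sparse:
  assumes "\<And>x. M_stationary f s x \<Longrightarrow> nondegenerate f s x" "s < CARD('n)" "x \<in> sparse_vecs s"
  shows "few_adjacent_components x
    (1 + (if type_I f s x then 1 else if type_II f s x then CARD('n) - s else 0))"
proof (cases "M_stationary f s x")
  case True
  then show ?thesis using few_adjacent_M_stationary assms by blast
next
  case False
  then have "\<not> type_I f s x" "\<not> type_II f s x" by (auto simp: type_I_def type_II_def)
  moreover obtain i where "i \<in> I1 x" "partial_deriv i f x \<noteq> 0"
    using False assms(3) by (auto simp: M_stationary_def)
  ultimately show ?thesis using few_adjacent_nonstationary[OF assms(3)] by simp
qed

section \<open>Isolation and finiteness of M-stationary points\<close>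

text \<open>Formulated for every feasible x, because an accumulation point of M-stationary points is
  not known to be M-stationary. Near a nondegenerate x, another M-stationary y has the same support:
  by ND1 if k < s, by counting if k = s. Then the projected gradient vanishes at y, and injectivity
  of the Hessian forces y = x.\<close>

lemma isolated_M_stationary:
  assumes x: "x \<in> sparse_vecs s" and nd: "M_stationary f s x \<Longrightarrow> nondegenerate f s x"
  shows "\<exists>e>0. \<forall>y. norm (y - x) < e \<longrightarrow> M_stationary f s y \<longrightarrow> y = x"
proof (cases "M_stationary f s x")
  case False
  then obtain i where i: "i \<in> I1 x" "partial_deriv i f x \<noteq> 0" using x by (auto simp: M_stationary_def)
  obtain r where "r > 0" "\<And>y. norm (y - x) < r \<Longrightarrow> I1 x \<subseteq> I1 y \<and> partial_deriv i f y \<noteq> 0"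
    using descent_radius[of "{i}" x] i by (metis singletonD singletonI)
  then show ?thesis using i by (intro exI[of _ r]) (auto simp: M_stationary_def)
next
  case True
  note nd = nd[OF True]
  let ?V = "coord_space (I1 x)"
  define A where "A = (if l0_norm x < s then I0 x else {})"
  have "partial_deriv j f x \<noteq> 0" if "j \<in> A" for j
    using nd that by (auto simp: A_def nondegenerate_def split: if_splits)
  then obtain r where r: "r > 0" "\<And>y. norm (y - x) < r \<Longrightarrow> I1 x \<subseteq> I1 y"
    "\<And>y j. norm (y - x) < r \<Longrightarrow> j \<in> A \<Longrightarrow> partial_deriv j f y \<noteq> 0"
    using descent_radius[of A x] by metis
  obtain B \<mu> where B: "finite B" "pairwise orthogonal B" "\<And>b. b \<in> B \<Longrightarrow> norm b = 1 \<and> hess x b = \<mu> b *\<^sub>R b"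
    "span B = ?V" "\<And>b. b \<in> B \<Longrightarrow> \<mu> b \<noteq> 0" and QI: "card {b \<in> B. \<mu> b < 0} = quadratic_index f x"
    by (rule hess_eigenbasis[OF nd]) (rule that)
  have "h = 0" if h: "h \<in> ?V" "hess x h = 0" for h
  proof -
    have "h \<bullet> b = 0" if b: "b \<in> B" for b
    proof -
      have "b \<in> ?V" using B(4) span_base[OF b] by simp
      then have "h \<bullet> hess x b = 0" using hess_selfadjoint[OF h(1)] h(2) by (metis inner_zero_left)
      then show ?thesis using B(3,5)[OF b] by simp
    qed
    then show ?thesis using orthonormal_basis_expand[of B h] B h(1) by simp
  qed
  \<comment> \<open>An injective linear map on the subspace is bounded below; an approximation error
    of at most \<beta> / 2 then excludes a second zero of the gradient.\<close>
  then obtain \<beta> where \<beta>: "\<beta> > 0" "\<And>h. h \<in> ?V \<Longrightarrow> \<beta> * norm h \<le> norm (hess x h)"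
    using injective_imp_isometric[of ?V "hess x"] closed_subspace[OF subspace_coord_space] subspace_coord_space
      linear_hess by (metis linear_conv_bounded_linear mult.commute)
  obtain \<delta> where \<delta>: "\<delta> > 0" "\<And>h. h \<in> ?V \<Longrightarrow> norm h < \<delta> \<Longrightarrow> norm (grad x h - hess x h) \<le> \<beta> / 2 * norm h"
    using grad_hess_approx[OF True, of "\<beta> / 2"] \<beta>(1) by auto
  have "y = x" if y: "norm (y - x) < min r \<delta>" "M_stationary f s y" for y
  proof -
    have sub: "I1 x \<subseteq> I1 y" using r(2) y by simp
    have cy: "card (I1 y) \<le> s" using y(2) by (simp add: M_stationary_def sparse_vecs_def l0_norm_def)
    have "I1 y \<subseteq> I1 x"
    proof (cases "l0_norm x < s")
      case True
      then show ?thesis using r(3)[of y] y by (auto simp: A_def M_stationary_def I0_def I1_def)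
    next
      case False
      then have "card (I1 y) \<le> card (I1 x)" using cy by (simp add: l0_norm_def)
      then show ?thesis using sub by (metis card_seteq finite order_refl)
    qed
    then have eq: "I1 y = I1 x" using sub by simp
    let ?h = "y - x"
    have h: "?h \<in> ?V" using eq by (auto simp: coord_space_def I1_def)
    have "grad x ?h = 0" using y(2) eq by (auto simp: grad_def vec_eq_iff M_stationary_def)
    then have "norm (hess x ?h) \<le> \<beta> / 2 * norm ?h" using \<delta>(2)[OF h] y(1) by simp
    with \<beta>(2)[OF h] have "\<beta> * norm ?h \<le> \<beta> / 2 * norm ?h" by linarith
    then show "y = x" using \<beta>(1) by simp
  qed
  then show ?thesis using r(1) \<delta>(1) by (intro exI[of _ "min r \<delta>"]) auto
qed

lemma finite_M_stationary:
  assumes K: "compact K" "K \<subseteq> sparse_vecs s" "{x. M_stationary f s x} \<subseteq> K"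
    and nd: "\<And>x. M_stationary f s x \<Longrightarrow> nondegenerate f s x"
  shows "finite {x. M_stationary f s x}"
proof (rule ccontr)
  assume "infinite {x. M_stationary f s x}"
  then obtain x where x: "x \<in> K" "x islimpt {x. M_stationary f s x}"
    using Heine_Borel_imp_Bolzano_Weierstrass[OF K(1) _ K(3)] by blast
  then obtain e where "e > 0" "\<And>y. norm (y - x) < e \<Longrightarrow> M_stationary f s y \<Longrightarrow> y = x"
    using isolated_M_stationary[of x] K(2) nd by blast
  then show False using x(2) by (auto simp: islimpt_approachable dist_norm)
qed

lemma local_minimizer_M_stationary:
  assumes "local_minimizer f s x"
  shows "M_stationary f s x"
proof (rule ccontr)
  assume "\<not> ?thesis"
  moreover have x: "x \<in> sparse_vecs s" using assms by (simp add: local_minimizer_def)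
  ultimately obtain i where i: "i \<in> I1 x" "partial_deriv i f x \<noteq> 0" by (auto simp: M_stationary_def)
  obtain e where e: "e > 0" "\<And>y. y \<in> sparse_vecs s \<Longrightarrow> y \<in> ball x e \<Longrightarrow> f x \<le> f y"
    using assms by (auto simp: local_minimizer_def)
  obtain r where r: "r > 0" "\<And>y t. 0 < t \<Longrightarrow> norm (y - x) + t < r \<Longrightarrow> f (y + t *\<^sub>R descent_dir x i) < f y"
    using descent_radius[of "{i}" x] i by (metis singletonD singletonI)
  define t where "t = min e r / 2"
  have t: "t > 0" "t < e" "t < r" using e r by (auto simp: t_def)
  let ?y = "x + t *\<^sub>R descent_dir x i"
  have "t * norm (descent_dir x i) \<le> t" using t norm_descent_dir[of x i] by (simp add: mult_left_le)
  then have "t * norm (descent_dir x i) < e" using t by linarith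
  then have "?y \<in> ball x e" using t by (simp add: dist_norm)
  moreover have "I1 ?y \<subseteq> I1 x" using I1_add_descent_dir[of x t x i] i by auto
  then have "?y \<in> sparse_vecs s" using x by (intro sparse_vecsI[of _ "I1 x"]) (auto simp: sparse_vecs_def l0_norm_def)
  ultimately have "f x \<le> f ?y" using e(2) by blast
  moreover have "f ?y < f x" using r(2)[OF t(1), of x] t by simp
  ultimately show False by simp
qed

end

section \<open>Merging of components and counting\<close>

text \<open>Take a largest vertex set S containing v0 that satisfies the bound with the edges inside
  S. If S is not all of V, connectedness yields an edge leaving S; adding its outer end adds one
  vertex and at least one edge, against maximality.\<close>

lemma card_le_edges_if_connected:
  assumes "finite V" "finite E" "E \<subseteq> V \<times> V"
    and conn: "\<And>u v. u \<in> V \<Longrightarrow> v \<in> V \<Longrightarrow> (u, v) \<in> (E \<union> E\<inverse>)\<^sup>*"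
  shows "card V \<le> card E + 1"
proof (cases "V = {}")
  case False
  then obtain v0 where v0: "v0 \<in> V" by blast
  let ?P = "\<lambda>S. S \<subseteq> V \<and> v0 \<in> S \<and> card S \<le> card (E \<inter> S \<times> S) + 1"
  have "\<exists>S. ?P S \<and> (\<forall>T. ?P T \<longrightarrow> card T \<le> card S)"
  proof (rule ex_has_greatest_nat[of ?P "{v0}" card "card V + 1"])
    show "?P {v0}" using v0 by simp
    show "\<forall>T. ?P T \<longrightarrow> card T < card V + 1" using assms(1) by (simp add: card_mono less_Suc_eq_le)
  qed
  then obtain S where S: "?P S" and max: "\<And>T. ?P T \<Longrightarrow> card T \<le> card S" by blast
  have finS: "finite S" using S assms(1) finite_subset by blast
  have "S = V"
  proof (rule ccontr)
    assume "S \<noteq> V"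
    then obtain v where v: "v \<in> V" "v \<notin> S" using S by blast
    have "\<exists>a b. (a, b) \<in> E \<union> E\<inverse> \<and> a \<in> S \<and> b \<notin> S"
    proof (rule ccontr)
      assume closed: "\<nexists>a b. (a, b) \<in> E \<union> E\<inverse> \<and> a \<in> S \<and> b \<notin> S"
      have "(v0, v) \<in> (E \<union> E\<inverse>)\<^sup>*" using conn v0 v by blast
      then have "v \<in> S"
      proof (induction rule: rtrancl_induct)
        case base show ?case using S by simp
      next
        case (step y z) then show ?case using closed by blast
      qed
      then show False using v by simp
    qed
    then obtain a b where ab: "(a, b) \<in> E \<union> E\<inverse>" "a \<in> S" "b \<notin> S" by blast
    then obtain c where c: "c \<in> E" "c = (a, b) \<or> c = (b, a)" by blast
    let ?S = "insert b S"
    have fin: "finite (E \<inter> ?S \<times> ?S)" using assms(2) by simp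
    have "insert c (E \<inter> S \<times> S) \<subseteq> E \<inter> ?S \<times> ?S" using c ab by auto
    then have "card (insert c (E \<inter> S \<times> S)) \<le> card (E \<inter> ?S \<times> ?S)" by (rule card_mono[OF fin])
    moreover have "c \<notin> E \<inter> S \<times> S" using c ab by auto
    ultimately have "card (E \<inter> S \<times> S) + 1 \<le> card (E \<inter> ?S \<times> ?S)" using assms(2) by simp
    moreover have "card ?S = card S + 1" using ab finS by simp
    moreover have "?S \<subseteq> V" using S ab assms(3) by auto
    ultimately have "?P ?S" using S by auto
    from max[OF this] show False using ab finS by simp
  qed
  moreover have "card (E \<inter> V \<times> V) \<le> card E" using assms(2) by (intro card_mono) auto
  ultimately show ?thesis using S by simp
qed simp

text \<open>\<open>g\<close> need not be injective, since representatives may share a minimizer; the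
  image of the star can then only lose edges or gain loops. For empty P the truncated subtraction
  gives 0, as required.\<close>

lemma star_edges:
  assumes "finite P"
  shows "\<exists>E. finite E \<and> card E \<le> card P - 1 \<and> E \<subseteq> g ` P \<times> g ` P \<and>
    (\<forall>p\<in>P. \<forall>q\<in>P. (g p, g q) \<in> (E \<union> E\<inverse>)\<^sup>*)"
proof (cases "P = {}")
  case False
  then obtain p0 where p0: "p0 \<in> P" by blast
  let ?E = "(\<lambda>p. (g p0, g p)) ` (P - {p0})"
  have "(g p0, g p) \<in> (?E \<union> ?E\<inverse>)\<^sup>*" "(g p, g p0) \<in> (?E \<union> ?E\<inverse>)\<^sup>*" if "p \<in> P" for p
    using that by (cases "p = p0"; blast)+
  then have "\<forall>p\<in>P. \<forall>q\<in>P. (g p, g q) \<in> (?E \<union> ?E\<inverse>)\<^sup>*" by (meson rtrancl_trans)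
  moreover have "card ?E \<le> card P - 1" using card_image_le[of "P - {p0}"] assms p0 by simp
  ultimately show ?thesis using assms p0 by (intro exI[of _ ?E]) auto
qed (intro exI[of _ "{}"], simp)

section \<open>Components of sublevel sets and their minimizers\<close>

locale proper_sparse_problem = sparse_problem f s for f :: "real ^ 'n::finite \<Rightarrow> real" and s +
  assumes s: "s < CARD('n)"
    and proper: "\<And>K. compact K \<Longrightarrow> compact (f -` K \<inter> sparse_vecs s)"
    and bdd: "bdd_below (f ` sparse_vecs s)"
    and nondeg: "\<And>x. M_stationary f s x \<Longrightarrow> nondegenerate f s x"
begin

definition minimizers :: "(real ^ 'n) set" where
  "minimizers = {x. local_minimizer f s x}"

text \<open>One less than the local bound on components: the number of edges of a star on their
  representatives.\<close>

definition merge_bound :: "real ^ 'n \<Rightarrow> nat" where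
  "merge_bound x = (if type_I f s x then 1 else if type_II f s x then CARD('n) - s else 0)"

text \<open>A lower bound m of f on the feasible set replaces the unbounded range of values by the
  compact interval from m to b, to which properness applies.\<close>

lemma compact_lower_level_set: "compact (lower_level_set f s b)"
proof -
  obtain m where m: "\<And>x. x \<in> sparse_vecs s \<Longrightarrow> m \<le> f x" using bdd by (auto simp: bdd_below_def)
  have "lower_level_set f s b = f -` {m..b} \<inter> sparse_vecs s" using m by (auto simp: lower_level_set_def)
  then show ?thesis using proper[of "{m..b}"] by simp
qed

text \<open>The straight segment to a nearby feasible y works: since \<open>I1 z\<close> is
  contained in \<open>I1 y\<close>, it stays feasible. Thus strict sublevel sets have relatively
  open path components in the feasible set.\<close>

lemma sublevel_nearby:
  assumes z: "z \<in> sublevel b"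
  shows "\<exists>e>0. \<forall>y\<in>sparse_vecs s. norm (y - z) < e \<longrightarrow> path_component (sublevel b) z y"
proof -
  obtain r where r: "r > 0" "\<And>y. norm (y - z) < r \<Longrightarrow> I1 z \<subseteq> I1 y" using I1_subset_nearby by blast
  obtain e where e: "e > 0" "\<And>y. norm (y - z) < e \<Longrightarrow> f y < b"
    using f_less_nearby[of z b] z by (auto simp: sublevel_def)
  have "path_component (sublevel b) z (z + (y - z))"
    if y: "y \<in> sparse_vecs s" "norm (y - z) < min e r" for y
  proof (rule path_component_segment)
    fix t :: real assume t: "0 \<le> t" "t \<le> 1"
    have "norm (z + t *\<^sub>R (y - z) - z) \<le> norm (y - z)" using t by (simp add: mult_left_le_one_le)
    then have "f (z + t *\<^sub>R (y - z)) < b" using y by (intro e) simp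
    moreover have "I1 (z + t *\<^sub>R (y - z)) \<subseteq> I1 y" using r(2)[of y] y by (auto simp: I1_def)
    then have "z + t *\<^sub>R (y - z) \<in> sparse_vecs s"
      using y by (intro sparse_vecsI[of _ "I1 y"]) (auto simp: sparse_vecs_def l0_norm_def)
    ultimately show "z + t *\<^sub>R (y - z) \<in> sublevel b" by (simp add: sublevel_def)
  qed
  then show ?thesis using r e by (intro exI[of _ "min e r"]) auto
qed

text \<open>Minimize f over the compact closure of the component. The minimizer z has f z \<le> f y
  < b, so it is not on the level b; by \<open>sublevel_nearby\<close> it belongs to the component
  together with all feasible points close to it, and is therefore a local minimizer.\<close>

lemma path_component_minimizer:
  assumes y: "y \<in> sublevel b"
  shows "\<exists>m\<in>minimizers. path_component (sublevel b) y m"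
proof -
  let ?D = "path_component_set (sublevel b) y" and ?L = "lower_level_set f s b"
  have yD: "y \<in> ?D" using y by (simp add: path_component_refl)
  have "?D \<subseteq> ?L" using path_component_subset[of "sublevel b" y] by (auto simp: sublevel_def lower_level_set_def)
  then have sub: "closure ?D \<subseteq> ?L"
    using compact_lower_level_set by (intro closure_minimal compact_imp_closed)
  then have "compact (closure ?D)" using compact_lower_level_set by (metis closed_closure compact_Int_closed inf.absorb_iff2)
  moreover have "closure ?D \<noteq> {}" using yD closure_subset by blast
  ultimately obtain z where z: "z \<in> closure ?D" "\<And>u. u \<in> closure ?D \<Longrightarrow> f z \<le> f u"
    using continuous_attains_inf[of "closure ?D" f] continuous_on_subset[OF continuous_f] by blast
  have "f z < b" using z(2)[of y] yD closure_subset[of ?D] y by (auto simp: sublevel_def)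
  then have zU: "z \<in> sublevel b" using z(1) sub by (auto simp: sublevel_def lower_level_set_def)
  then obtain e where e: "e > 0" "\<And>u. u \<in> sparse_vecs s \<Longrightarrow> norm (u - z) < e \<Longrightarrow> path_component (sublevel b) z u"
    using sublevel_nearby by blast
  obtain u where u: "u \<in> ?D" "norm (u - z) < e"
    using z(1) e(1) by (auto simp: closure_approachable dist_norm)
  then have "u \<in> sparse_vecs s" using path_component_subset[of "sublevel b" y] by (auto simp: sublevel_def)
  then have yz: "path_component (sublevel b) y z"
    using e(2)[of u] u by (metis mem_Collect_eq path_component_sym path_component_trans)
  have "f z \<le> f w" if w: "w \<in> sparse_vecs s" "w \<in> ball z e" for w
  proof -
    have "norm (w - z) < e" using w by (simp add: dist_norm norm_minus_commute)
    then have "w \<in> ?D" using e(2)[OF w(1)] yz path_component_trans by blast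
    then show ?thesis using z(2) closure_subset by blast
  qed
  then have "local_minimizer f s z" using zU e(1) unfolding local_minimizer_def sublevel_def by blast
  then show ?thesis using yz by (auto simp: minimizers_def)
qed

lemma merging_edges:
  assumes x: "x \<in> sparse_vecs s"
  shows "\<exists>E. finite E \<and> card E \<le> merge_bound x \<and> E \<subseteq> minimizers \<times> minimizers \<and>
    (\<exists>e>0. \<forall>y\<in>sublevel (f x). \<forall>z\<in>sublevel (f x). norm (y - x) < e \<longrightarrow> norm (z - x) < e \<longrightarrow>
      (\<exists>u\<in>minimizers. \<exists>v\<in>minimizers. path_component (sublevel (f x)) y u \<and>
        path_component (sublevel (f x)) z v \<and> (u, v) \<in> (E \<union> E\<inverse>)\<^sup>*))"
proof -
  let ?U = "sublevel (f x)"
  have "few_adjacent_components x (1 + merge_bound x)"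
    unfolding merge_bound_def using nondeg s x by (rule few_adjacent_components_sparse)
  then obtain e P where e: "e > 0" and P: "finite P" "card P \<le> 1 + merge_bound x" "P \<subseteq> ?U"
    and adj: "\<And>y. y \<in> ?U \<Longrightarrow> norm (y - x) < e \<Longrightarrow> \<exists>p\<in>P. path_component ?U y p"
    unfolding few_adjacent_components_def by blast
  have "\<forall>p\<in>P. \<exists>m\<in>minimizers. path_component ?U p m" using P(3) path_component_minimizer by blast
  then obtain g where g: "\<And>p. p \<in> P \<Longrightarrow> g p \<in> minimizers \<and> path_component ?U p (g p)" by metis
  obtain E where E: "finite E" "card E \<le> card P - 1" "E \<subseteq> g ` P \<times> g ` P"
    "\<And>p q. p \<in> P \<Longrightarrow> q \<in> P \<Longrightarrow> (g p, g q) \<in> (E \<union> E\<inverse>)\<^sup>*"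
    using star_edges[OF P(1), of g] by blast
  have "\<exists>u\<in>minimizers. \<exists>v\<in>minimizers. path_component ?U y u \<and> path_component ?U z v \<and> (u, v) \<in> (E \<union> E\<inverse>)\<^sup>*"
    if yz: "y \<in> ?U" "z \<in> ?U" "norm (y - x) < e" "norm (z - x) < e" for y z
  proof -
    obtain p q where pq: "p \<in> P" "q \<in> P" "path_component ?U y p" "path_component ?U z q"
      using adj yz by blast
    then have "path_component ?U y (g p)" "path_component ?U z (g q)"
      using g path_component_trans by blast+
    then show ?thesis using g E(4) pq by blast
  qed
  moreover have "E \<subseteq> minimizers \<times> minimizers" using E(3) g by blast
  moreover have "card E \<le> merge_bound x" using E(2) P(2) by simp
  ultimately show ?thesis using E(1) e by blast
qed

text \<open>If some connected pair of minimizers were not joined by edges, take one whose merging level \<open>b\<close> is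
  lowest. The closures of the components of the strict sublevel set at \<open>b\<close> cover the connecting continuum,
  and two of them can only meet at a point whose edges join their minimizers.\<close>

lemma minimizers_edge_connected:
  assumes fin: "finite minimizers"
    and edges: "\<And>x. x \<in> sparse_vecs s \<Longrightarrow> \<exists>e>0. \<forall>y\<in>sublevel (f x). \<forall>z\<in>sublevel (f x).
      norm (y - x) < e \<longrightarrow> norm (z - x) < e \<longrightarrow>
      (\<exists>u\<in>minimizers. \<exists>v\<in>minimizers. path_component (sublevel (f x)) y u \<and>
        path_component (sublevel (f x)) z v \<and> (u, v) \<in> R)"
    and R: "refl R" "sym R" "trans R"
    and mm: "m0 \<in> minimizers" "m1 \<in> minimizers" "connected_component (lower_level_set f s d) m0 m1"
  shows "(m0, m1) \<in> R"
proof (rule ccontr)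
  assume notR: "(m0, m1) \<notin> R"
  let ?L = "lower_level_set f s"
  \<comment> \<open>The infimum of \<open>levels p\<close> is the merging level of the pair p. The
    set is bounded below by \<open>f (fst p)\<close>, and nonempty for pairs in \<open>bad\<close>,
    so \<open>Inf\<close> has its usual meaning there.\<close>
  define levels where "levels p = {b. connected_component (?L b) (fst p) (snd p)}" for p
  define bad where "bad = {p \<in> minimizers \<times> minimizers. p \<notin> R \<and> levels p \<noteq> {}}"
  have "finite bad" using fin by (simp add: bad_def)
  moreover have "(m0, m1) \<in> bad" using mm notR by (auto simp: bad_def levels_def)
  then have "bad \<noteq> {}" by blast
  ultimately obtain p where "is_arg_min (\<lambda>q. Inf (levels q)) (\<lambda>q. q \<in> bad) p"
    using ex_is_arg_min_if_finite by blast
  then have p: "p \<in> bad" and pmin: "\<And>q. q \<in> bad \<Longrightarrow> Inf (levels p) \<le> Inf (levels q)"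
    by (auto simp: is_arg_min_linorder)
  obtain m m' where pm: "p = (m, m')" by (cases p)
  define b where "b = Inf (levels p)"
  have bddl: "bdd_below (levels q)" for q
    by (rule bdd_belowI[of _ "f (fst q)"]) (use connected_component_in in \<open>force simp: levels_def lower_level_set_def\<close>)
  have mono: "?L a \<subseteq> ?L c" if "a \<le> c" for a c using that by (auto simp: lower_level_set_def)
  have mM: "m \<in> minimizers" "m' \<in> minimizers" "(m, m') \<notin> R" "levels p \<noteq> {}"
    using p by (auto simp: bad_def pm)
  \<comment> \<open>The merging level is attained: C is the intersection of the nested compact
    connected components of m at the levels b + 1 / (n + 1).\<close>
  obtain C where C: "connected C" "C \<subseteq> ?L b" "m \<in> C" "m' \<in> C"
  proof -
    let ?S = "\<lambda>n. connected_component_set (?L (b + 1 / (real n + 1))) m"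
    have cc: "connected_component (?L (b + 1 / (real n + 1))) m m'" for n
    proof -
      have "Inf (levels p) < b + 1 / (real n + 1)" by (simp add: b_def)
      then obtain c where "c \<in> levels p" "c < b + 1 / (real n + 1)"
        using cInf_lessD[OF mM(4)] by blast
      then show ?thesis using mono[of c "b + 1 / (real n + 1)"]
        by (auto simp: levels_def pm intro: connected_component_of_subset)
    qed
    have "connected (\<Inter> (range ?S))"
    proof (rule connected_nest)
      show "compact (?S n)" for n
        using compact_lower_level_set connected_component_subset closed_connected_component
        by (metis compact_Int_closed compact_imp_closed inf.absorb_iff2)
      show "connected (?S n)" for n by (rule connected_connected_component)
      show "?S n \<subseteq> ?S k" if "k \<le> n" for k n
        using that by (intro connected_component_mono mono) (simp add: frac_le)
    qed
    moreover have "\<Inter> (range ?S) \<subseteq> ?L b"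
    proof
      fix y assume "y \<in> \<Inter> (range ?S)"
      then have y: "y \<in> ?L (b + 1 / (real n + 1))" for n using connected_component_in by blast
      have "f y \<le> b"
      proof (rule field_le_epsilon)
        fix e :: real assume "e > 0"
        then obtain n where "1 / (real n + 1) < e" using nat_approx_posE[of e] by (metis of_nat_Suc add.commute)
        then show "f y \<le> b + e" using y[of n] by (simp add: lower_level_set_def)
      qed
      then show "y \<in> ?L b" using y[of 0] by (simp add: lower_level_set_def)
    qed
    moreover have "m \<in> \<Inter> (range ?S)" "m' \<in> \<Inter> (range ?S)"
      using cc connected_component_in[OF cc] by (auto intro: connected_component_refl)
    ultimately show ?thesis by (rule that)
  qed
  let ?U = "sublevel b"
  \<comment> \<open>The maximum of f on a path strictly below b is itself below b. So the merging
    level of (u, v) is below b, and minimality of b prevents the pair from being bad.\<close>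
  have pcR: "(u, v) \<in> R" if uv: "u \<in> minimizers" "v \<in> minimizers" "path_component ?U u v" for u v
  proof (rule ccontr)
    assume nR: "(u, v) \<notin> R"
    obtain g where g: "path g" "path_image g \<subseteq> ?U" "pathstart g = u" "pathfinish g = v"
      using uv(3) by (auto simp: path_component_def)
    have "compact (path_image g)" "path_image g \<noteq> {}" using g(1) by (auto simp: compact_path_image)
    then obtain z where z: "z \<in> path_image g" "\<And>y. y \<in> path_image g \<Longrightarrow> f y \<le> f z"
      using continuous_attains_sup[of "path_image g" f] continuous_on_subset[OF continuous_f] by blast
    have "path_image g \<subseteq> ?L (f z)" using g(2) z(2) by (auto simp: lower_level_set_def sublevel_def)
    then have "connected_component (?L (f z)) u v"
      unfolding connected_component_def
      using g connected_path_image[OF g(1)] by (metis pathfinish_in_path_image pathstart_in_path_image)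
    then have "f z \<in> levels (u, v)" by (simp add: levels_def)
    then have "(u, v) \<in> bad" "Inf (levels (u, v)) \<le> f z"
      using uv nR bddl by (auto simp: bad_def intro: cInf_lower)
    moreover have "f z < b" using g(2) z(1) by (auto simp: sublevel_def)
    ultimately show False using pmin[of "(u, v)"] by (simp add: b_def)
  qed
  \<comment> \<open>The insertion of u matters when u is not strictly below level b: its path
    component in the sublevel set is then empty.\<close>
  let ?K = "\<lambda>u. closure (insert u (path_component_set ?U u))"
  \<comment> \<open>A point at level b that is not a local minimizer is a limit of points strictly
    below b, whose components contain minimizers. The union of the sets \<open>?K u\<close> is
    closed because it is finite.\<close>
  have cover: "\<exists>u\<in>minimizers. y \<in> ?K u" if y: "y \<in> ?L b" for y
  proof (cases "y \<in> minimizers")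
    case True
    then show ?thesis using closure_subset by blast
  next
    case False
    let ?Q = "\<Union>u\<in>minimizers. path_component_set ?U u"
    have "\<exists>z\<in>?Q. norm (z - y) < e" if e: "e > 0" for e
    proof -
      have "\<exists>z\<in>?U. norm (z - y) < e"
      proof (cases "f y < b")
        case True
        then show ?thesis using y e by (intro bexI[of _ y]) (auto simp: sublevel_def lower_level_set_def)
      next
        case fy: False
        then have "f y = b" using y by (simp add: lower_level_set_def)
        moreover obtain z where "z \<in> sparse_vecs s" "z \<in> ball y e" "f z < f y"
          using False y e unfolding minimizers_def local_minimizer_def lower_level_set_def
          by (auto simp: not_le)
        ultimately show ?thesis by (intro bexI[of _ z]) (auto simp: sublevel_def dist_norm norm_minus_commute)
      qed
      then obtain z where z: "z \<in> ?U" "norm (z - y) < e" by blast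
      then show ?thesis using path_component_minimizer[OF z(1)] path_component_sym by blast
    qed
    then have "y \<in> closure ?Q" unfolding closure_approachable dist_norm by blast
    also have "closure ?Q \<subseteq> (\<Union>u\<in>minimizers. ?K u)"
    proof (rule closure_minimal)
      show "?Q \<subseteq> (\<Union>u\<in>minimizers. ?K u)" using closure_subset by fast
      show "closed (\<Union>u\<in>minimizers. ?K u)" using fin by (intro closed_UN) auto
    qed
    finally show ?thesis by blast
  qed
  have approach: "\<exists>z. path_component ?U u z \<and> norm (z - y) < e" if "y \<in> ?K u" "u \<noteq> y" "e > 0" for y u e
  proof -
    \<comment> \<open>A radius at most the distance from u to y rules out the inserted point u
      itself, so the nearby point found lies in the component.\<close>
    have pos: "min e (norm (u - y)) > 0" using that by simp
    have near: "\<forall>e>0. \<exists>z\<in>insert u (path_component_set ?U u). norm (z - y) < e"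
      using that(1) unfolding closure_approachable dist_norm .
    have "\<exists>z\<in>insert u (path_component_set ?U u). norm (z - y) < min e (norm (u - y))"
      using near[rule_format, OF pos] .
    then show ?thesis by auto
  qed
  \<comment> \<open>Three cases: below b the two components coincide; at a local minimizer on level
    b no component accumulates, so u = v = y; at any other point on level b the edges attached to y
    link the two components.\<close>
  have meet: "(u, v) \<in> R" if y: "y \<in> ?L b" and uv: "u \<in> minimizers" "v \<in> minimizers" "y \<in> ?K u" "y \<in> ?K v" for y u v
  proof (cases "f y < b")
    case True
    then have yU: "y \<in> ?U" using y by (simp add: sublevel_def lower_level_set_def)
    then obtain e where e: "e > 0" "\<And>z. z \<in> sparse_vecs s \<Longrightarrow> norm (z - y) < e \<Longrightarrow> path_component ?U y z"
      using sublevel_nearby by blast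
    have "path_component ?U y w" if w: "w \<in> minimizers" "y \<in> ?K w" for w
    proof (cases "w = y")
      case True
      then show ?thesis using yU by (simp add: path_component_refl)
    next
      case False
      from approach[OF w(2) this e(1)] obtain z where z: "path_component ?U w z" "norm (z - y) < e" by blast
      then have "z \<in> sparse_vecs s" using path_component_mem(2)[OF z(1)] by (simp add: sublevel_def)
      then show ?thesis using e(2) z by (metis path_component_sym path_component_trans)
    qed
    from this[OF uv(1,3)] this[OF uv(2,4)] have "path_component ?U u v"
      by (metis path_component_sym path_component_trans)
    then show ?thesis by (rule pcR[OF uv(1,2)])
  next
    case False
    then have fy: "f y = b" using y by (simp add: lower_level_set_def)
    show ?thesis
    proof (cases "y \<in> minimizers")
      case True
      then obtain e where e: "e > 0" "\<And>z. z \<in> sparse_vecs s \<Longrightarrow> z \<in> ball y e \<Longrightarrow> f y \<le> f z"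
        by (auto simp: minimizers_def local_minimizer_def)
      have "w = y" if "y \<in> ?K w" for w
      proof (rule ccontr)
        assume "w \<noteq> y"
        from approach[OF that this e(1)] obtain z where z: "path_component ?U w z" "norm (z - y) < e" by blast
        then have "z \<in> sparse_vecs s" "f z < b" using path_component_mem(2)[OF z(1)] by (simp_all add: sublevel_def)
        then show False using e(2)[of z] z(2) fy by (simp add: dist_norm norm_minus_commute)
      qed
      then show ?thesis using uv R(1) by (metis reflD)
    next
      case ny: False
      have "y \<in> sparse_vecs s" using y by (simp add: lower_level_set_def)
      then obtain e where e: "e > 0" "\<And>z z'. z \<in> ?U \<Longrightarrow> z' \<in> ?U \<Longrightarrow> norm (z - y) < e \<Longrightarrow> norm (z' - y) < e \<Longrightarrow>
        \<exists>u\<in>minimizers. \<exists>v\<in>minimizers. path_component ?U z u \<and> path_component ?U z' v \<and> (u, v) \<in> R"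
        using edges[of y] unfolding fy by blast
      have "u \<noteq> y" "v \<noteq> y" using ny uv by auto
      from approach[OF uv(3) this(1) e(1)] approach[OF uv(4) this(2) e(1)]
      obtain z z' where z: "path_component ?U u z" "norm (z - y) < e"
        and z': "path_component ?U v z'" "norm (z' - y) < e" by blast
      obtain u' v' where uv': "u' \<in> minimizers" "v' \<in> minimizers" "path_component ?U z u'" "path_component ?U z' v'"
        "(u', v') \<in> R"
        using e(2)[of z z'] z z' path_component_mem(2) by meson
      have "(u, u') \<in> R" by (rule pcR[OF uv(1) uv'(1) path_component_trans[OF z(1) uv'(3)]])
      moreover have "(v, v') \<in> R" by (rule pcR[OF uv(2) uv'(2) path_component_trans[OF z'(1) uv'(4)]])
      ultimately show ?thesis using uv'(5) R(2,3) by (meson symD transD)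
    qed
  qed
  \<comment> \<open>The cover of C is split according to whether the minimizer is R-related to m. By
    \<open>meet\<close> and transitivity the two closed parts do not meet on C, yet m and m' lie in
    different parts, against connectedness.\<close>
  let ?A1 = "\<Union>u\<in>{u \<in> minimizers. (m, u) \<in> R}. ?K u" and ?A2 = "\<Union>u\<in>{u \<in> minimizers. (m, u) \<notin> R}. ?K u"
  have closed: "closed ?A1" "closed ?A2" using fin by (auto intro!: closed_UN)
  have cov: "C \<subseteq> ?A1 \<union> ?A2" using cover C(2) by blast
  have disj: "?A1 \<inter> ?A2 \<inter> C = {}"
  proof (rule ccontr)
    assume "?A1 \<inter> ?A2 \<inter> C \<noteq> {}"
    then obtain y u v where yuv: "y \<in> C" "u \<in> minimizers" "(m, u) \<in> R" "y \<in> ?K u" "v \<in> minimizers" "(m, v) \<notin> R" "y \<in> ?K v"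
      by blast
    then have "(u, v) \<in> R" using meet[of y u v] C(2) by blast
    then show False using yuv R(3) by (meson transD)
  qed
  have mA: "m \<in> ?A1 \<inter> C"
    using mM(1) C(3) R(1) closure_subset[of "insert m (path_component_set ?U m)"] by (auto simp: refl_on_def)
  have mA': "m' \<in> ?A2 \<inter> C"
    using mM(2,3) C(4) closure_subset[of "insert m' (path_component_set ?U m')"] by auto
  have "?A1 \<inter> C \<noteq> {}" using mA by (metis empty_iff)
  moreover have "?A2 \<inter> C \<noteq> {}" using mA' by (metis empty_iff)
  ultimately have "\<exists>A1 A2. closed A1 \<and> closed A2 \<and> C \<subseteq> A1 \<union> A2 \<and> A1 \<inter> A2 \<inter> C = {} \<and> A1 \<inter> C \<noteq> {} \<and> A2 \<inter> C \<noteq> {}"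
    using closed cov disj by (intro exI[of _ ?A1] exI[of _ ?A2] conjI)
  then show False using C(1) unfolding connected_closed by (rule notE[rotated])
qed

text \<open>The graph on the minimizers has as edges the union F of the stars at the points of type
  (I) and (II); it is connected because the given connected level set contains every
  minimizer.\<close>

lemma minimizer_count_bound:
  assumes conn: "connected (lower_level_set f s d)" and sub: "{x. M_stationary f s x} \<subseteq> lower_level_set f s d"
  shows "finite {x. M_stationary f s x}"
    and "card minimizers \<le> card {x. type_I f s x} + (CARD('n) - s) * card {x. type_II f s x} + 1"
proof -
  show finM: "finite {x. M_stationary f s x}"
    using compact_lower_level_set _ sub nondeg by (rule finite_M_stationary) (auto simp: lower_level_set_def)
  have minM: "minimizers \<subseteq> {x. M_stationary f s x}"
    using local_minimizer_M_stationary by (auto simp: minimizers_def)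
  then have fin: "finite minimizers" using finM finite_subset by blast
  let ?I = "{x. type_I f s x}" and ?II = "{x. type_II f s x}"
  have finT: "finite ?I" "finite ?II" using finM by (auto simp: type_I_def type_II_def intro: finite_subset)
  have disj: "?I \<inter> ?II = {}" by (auto simp: type_I_def type_II_def)
  obtain E where E: "\<And>x. x \<in> sparse_vecs s \<Longrightarrow> finite (E x) \<and> card (E x) \<le> merge_bound x \<and> E x \<subseteq> minimizers \<times> minimizers \<and>
    (\<exists>e>0. \<forall>y\<in>sublevel (f x). \<forall>z\<in>sublevel (f x). norm (y - x) < e \<longrightarrow> norm (z - x) < e \<longrightarrow>
      (\<exists>u\<in>minimizers. \<exists>v\<in>minimizers. path_component (sublevel (f x)) y u \<and>
        path_component (sublevel (f x)) z v \<and> (u, v) \<in> (E x \<union> (E x)\<inverse>)\<^sup>*))"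
    using merging_edges by metis
  define F where "F = (\<Union>x\<in>?I \<union> ?II. E x)"
  have sp: "x \<in> sparse_vecs s" if "x \<in> ?I \<union> ?II" for x
    using that by (auto simp: type_I_def type_II_def M_stationary_def)
  have finF: "finite F" "F \<subseteq> minimizers \<times> minimizers" using E sp finT by (auto simp: F_def)
  have "card F \<le> (\<Sum>x\<in>?I \<union> ?II. card (E x))" unfolding F_def using finT by (intro card_UN_le) auto
  also have "\<dots> \<le> (\<Sum>x\<in>?I \<union> ?II. merge_bound x)" using E sp by (intro sum_mono) blast
  also have "\<dots> = (\<Sum>x\<in>?I. merge_bound x) + (\<Sum>x\<in>?II. merge_bound x)"
    using finT disj by (rule sum.union_disjoint)
  also have "(\<Sum>x\<in>?I. merge_bound x) = card ?I" by (simp add: merge_bound_def)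
  also have "(\<Sum>x\<in>?II. merge_bound x) = (\<Sum>x\<in>?II. CARD('n) - s)"
    using disj by (intro sum.cong) (auto simp: merge_bound_def)
  finally have cardF: "card F \<le> card ?I + (CARD('n) - s) * card ?II" by (simp add: mult.commute)
  let ?R = "(F \<union> F\<inverse>)\<^sup>*"
  have sym: "sym ?R" by (simp add: sym_rtrancl sym_Un_converse)
  have ER: "(E x \<union> (E x)\<inverse>)\<^sup>* \<subseteq> ?R" if x: "x \<in> sparse_vecs s" for x
  proof (rule rtrancl_mono)
    show "E x \<union> (E x)\<inverse> \<subseteq> F \<union> F\<inverse>"
    proof (cases "x \<in> ?I \<union> ?II")
      case False
      \<comment> \<open>At all other feasible points the merging bound is 0, so no edge is attached
        there. Hence the finitely many edges in F suffice for the local condition at every feasible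
        x.\<close>
      then have "card (E x) = 0" "finite (E x)" using E[OF x] by (simp_all add: merge_bound_def)
      then have "E x = {}" by simp
      then show ?thesis by simp
    qed (auto simp: F_def)
  qed
  have "(u, v) \<in> ?R" if uv: "u \<in> minimizers" "v \<in> minimizers" for u v
  proof (rule minimizers_edge_connected[OF fin _ refl_rtrancl sym trans_rtrancl uv])
    show "connected_component (lower_level_set f s d) u v"
      unfolding connected_component_def using conn sub minM uv by blast
    fix x :: "real ^ 'n" assume x: "x \<in> sparse_vecs s"
    show "\<exists>e>0. \<forall>y\<in>sublevel (f x). \<forall>z\<in>sublevel (f x). norm (y - x) < e \<longrightarrow> norm (z - x) < e \<longrightarrow>
      (\<exists>u\<in>minimizers. \<exists>v\<in>minimizers. path_component (sublevel (f x)) y u \<and>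
        path_component (sublevel (f x)) z v \<and> (u, v) \<in> ?R)"
      using E[OF x] ER[OF x] by (meson subsetD)
  qed
  then have "card minimizers \<le> card F + 1" by (intro card_le_edges_if_connected fin finF)
  then show "card minimizers \<le> card ?I + (CARD('n) - s) * card ?II + 1" using cardF by linarith
qed

end

theorem theorem6:
  fixes f :: "real ^ 'n::finite \<Rightarrow> real" and s :: nat and d :: real
  assumes "s < CARD('n)"
    and "C_k 2 f"
    and "\<And>K. compact K \<Longrightarrow> compact (f -` K \<inter> sparse_vecs s)"
    and "bdd_below (f ` sparse_vecs s)"
    and "\<And>x. M_stationary f s x \<Longrightarrow> nondegenerate f s x"
    and "connected (lower_level_set f s d)"
    and "{x. M_stationary f s x} \<subseteq> lower_level_set f s d"
  shows "finite {x. local_minimizer f s x} \<and> finite {x. type_I f s x} \<and> finite {x. type_II f s x} \<and>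
    int (card {x. type_I f s x}) + (int CARD('n) - int s) * int (card {x. type_II f s x})
      \<ge> int (card {x. local_minimizer f s x}) - 1"
proof -
  interpret proper_sparse_problem f s using assms by unfold_locales auto
  note fin = minimizer_count_bound(1)[OF assms(6,7)]
  \<comment> \<open>Since \<open>card\<close> is 0 on infinite sets, finiteness is what makes the
    three cardinalities genuine counts.\<close>
  have "finite {x. local_minimizer f s x}" "finite {x. type_I f s x}" "finite {x. type_II f s x}"
    using fin local_minimizer_M_stationary by (auto simp: type_I_def type_II_def elim!: rev_finite_subset)
  moreover have "int (card {x. local_minimizer f s x}) \<le>
      int (card {x. type_I f s x} + (CARD('n) - s) * card {x. type_II f s x} + 1)"
    using minimizer_count_bound(2)[OF assms(6,7)] unfolding minimizers_def by (simp only: of_nat_le_iff)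
  \<comment> \<open>With s < \<open>CARD('n)\<close> the truncated subtraction agrees with the
    integer one.\<close>
  ultimately show ?thesis using assms(1) by (simp add: of_nat_diff)
qed

end
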